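(* Let $n_1,n_2\in N^+$. The following relations hold in the group $G$. (a) Suppose that $\{n_2,n_1\}=0$. Then for any $a_1,a_2\in(1/\delta_0)\mathbb{Z}_{>0}$ and $b_1,b_2\in(1/\delta_0)\mathbb{Z}$, $$\Psi_{a_2,b_2}[n_2]\,\Psi_{a_1,b_1}[n_1]=\Psi_{a_1,b_1}[n_1]\,\Psi_{a_2,b_2}[n_2].$$ (b) (Pentagon relation.) Suppose that $\{n_2,n_1\}=c$ with $c\in(1/\delta_0)\mathbb{Z}_{>0}$. Then for any $b_1,b_2\in(1/\delta_0)\mathbb{Z}$, $$\Psi_{c,b_2}[n_2]\,\Psi_{c,b_1}[n_1]=\Psi_{c,b_1}[n_1]\,\Psi_{c,b_1+b_2}[n_1+n_2]\,\Psi_{c,b_2}[n_2].$$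
   Context: Fixed data: $N$ is a lattice of finite rank $r$ with basis $(e_1,\dots,e_r)$; $\{\cdot,\cdot\}:N\times N\to\mathbb{Q}$ is a skew-symmetric bilinear form; $\delta_1,\dots,\delta_r$ are positive integers such that the sublattice $N^\circ=\bigoplus_i\mathbb{Z}\,\delta_ie_i$ satisfies $\{N^\circ,N\}\subset\mathbb{Z}$. Let $\delta_0=\mathrm{lcm}(\delta_1,\dots,\delta_r)$; then $\{\cdot,\cdot\}$ takes values in $(1/\delta_0)\mathbb{Z}$. Let $N^+=\{\sum_i a_ie_i\mid a_i\in\mathbb{Z}_{\ge0},\ \sum_i a_i>0\}$ and $\deg(\sum_i a_ie_i)=\sum_i a_i$. Let $q$ be an indeterminate and, for $\alpha\in(1/\delta_0)\mathbb{Z}$, let $[\alpha]_q=\frac{q^\alpha-q^{-\alpha}}{q-q^{-1}}\in\mathbb{Q}(q^{1/\delta_0})$. Let $\mathfrak{g}=\bigoplus_{n\in N^+}\mathbb{Q}(q^{1/\delta_0})X_n$ be the $N^+$-graded Lie algebra over $\mathbb{Q}(q^{1/\delta_0})$ with bracket $[X_n,X_{n'}]=[\{n,n'\}]_q\,X_{n+n'}$. Let $\widehat{\mathfrak{g}}$ be its completion with respect to $\deg$ (infinite sums $\sum_{n\in N^+}c_nX_n$ allowed), and let $G=\exp(\widehat{\mathfrak{g}})$ be the group of formal exponentials with product given by the Baker–Campbell–Hausdorff formula. For $n\in N^+$, $a\in(1/\delta_0)\mathbb{Z}_{>0}$, $b\in(1/\delta_0)\mathbb{Z}$, the quantum dilogarithm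 element is $$\Psi_{a,b}[n]=\exp\Bigl(\sum_{j=1}^\infty\frac{(-1)^{j+1}}{j\,[ja]_q}\,q^{jb}X_{jn}\Bigr)\in G.$$ *)

theory Defs
  imports
    "HOL-Analysis.Finite_Cartesian_Product"
    "HOL-Computational_Algebra.Polynomial"
    "HOL-Computational_Algebra.Fraction_Field"
    "HOL-Algebra.Group"
begin

text \<open>The lattice \<open>N\<close>, written in the coordinates of its basis \<open>e\<^sub>1, \<dots>, e\<^sub>r\<close>, is \<open>int ^ 'r\<close>
  with \<open>r = CARD('r)\<close>.\<close>

definition sublattice :: "('r::finite \<Rightarrow> nat) \<Rightarrow> (int ^ 'r) set" where
  "sublattice \<delta> = range (\<lambda>a. \<Sum>i\<in>UNIV. (a i * int (\<delta> i)) *s axis i 1)"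

locale fixed_data =
  fixes B :: "int ^ 'r::finite \<Rightarrow> int ^ 'r \<Rightarrow> rat"
    and \<delta> :: "'r \<Rightarrow> nat"
  assumes form_add_left: "B (x + y) z = B x z + B y z"
    and form_add_right: "B x (y + z) = B x y + B x z"
    and form_skew: "B x y = - B y x"
    and \<delta>_pos: "\<delta> i > 0"
    and form_integral: "x \<in> sublattice \<delta> \<Longrightarrow> B x y \<in> \<int>"

definition \<delta>\<^sub>0 :: "('r::finite \<Rightarrow> nat) \<Rightarrow> nat" where
  "\<delta>\<^sub>0 \<delta> = Lcm (range \<delta>)"

definition frac_ints :: "('r::finite \<Rightarrow> nat) \<Rightarrow> rat set" where
  "frac_ints \<delta> = range (\<lambda>k::int. of_int k / of_nat (\<delta>\<^sub>0 \<delta>))"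

definition deg :: "int ^ 'r::finite \<Rightarrow> int" where
  "deg n = (\<Sum>i\<in>UNIV. n $ i)"

definition Nplus :: "(int ^ 'r::finite) set" where
  "Nplus = {n. (\<forall>i. 0 \<le> n $ i) \<and> 0 < deg n}"


text \<open>The field \<open>\<rat>(q\<^bsup>1/\<delta>\<^sub>0\<^esup>)\<close> is the field of rational functions over \<open>\<rat>\<close> in the variable
  \<open>q_root\<close>, which stands for \<open>q\<^bsup>1/\<delta>\<^sub>0\<^esup>\<close>.\<close>

type_synonym qfield = "rat poly fract"

definition q_root :: qfield where
  "q_root = Fract [:0, 1:] 1"

text \<open>For \<open>\<alpha>\<close> in \<open>(1/\<delta>\<^sub>0)\<int>\<close>, the only exponents that occur, \<open>\<alpha> \<cdot> \<delta>\<^sub>0\<close> is an integer and the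
  floor merely converts its type.\<close>

definition qpow :: "('r::finite \<Rightarrow> nat) \<Rightarrow> rat \<Rightarrow> qfield" where
  "qpow \<delta> \<alpha> = q_root powi \<lfloor>\<alpha> * of_nat (\<delta>\<^sub>0 \<delta>)\<rfloor>"

definition qnum :: "('r::finite \<Rightarrow> nat) \<Rightarrow> rat \<Rightarrow> qfield" where
  "qnum \<delta> \<alpha> = (qpow \<delta> \<alpha> - qpow \<delta> (- \<alpha>)) / (qpow \<delta> 1 - qpow \<delta> (- 1))"


text \<open>An element \<open>\<Sum>\<^sub>n c\<^sub>n X\<^sub>n\<close> of the completed Lie algebra is represented by its coefficient
  function \<open>c\<close>, supported on \<open>Nplus\<close>.\<close>

type_synonym 'r coeffs = "int ^ 'r \<Rightarrow> qfield"

definition ghat :: "('r::finite) coeffs set" where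
  "ghat = {x. \<forall>n. n \<notin> Nplus \<longrightarrow> x n = 0}"

definition X :: "int ^ 'r \<Rightarrow> ('r::finite) coeffs" where
  "X n = (\<lambda>m. if m = n then 1 else 0)"

definition bracket ::
  "(int ^ 'r \<Rightarrow> int ^ 'r \<Rightarrow> rat) \<Rightarrow> ('r::finite \<Rightarrow> nat) \<Rightarrow> 'r coeffs \<Rightarrow> 'r coeffs \<Rightarrow> 'r coeffs" where
  "bracket B \<delta> x y =
     (\<lambda>n. \<Sum>(k, l) \<in> {(k, l). k \<in> Nplus \<and> l \<in> Nplus \<and> k + l = n}. x k * y l * qnum \<delta> (B k l))"

fun nested_bracket ::
  "(int ^ 'r \<Rightarrow> int ^ 'r \<Rightarrow> rat) \<Rightarrow> ('r::finite \<Rightarrow> nat) \<Rightarrow> 'r coeffs list \<Rightarrow> 'r coeffs" where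
  "nested_bracket B \<delta> [] = (\<lambda>_. 0)"
| "nested_bracket B \<delta> [x] = x"
| "nested_bracket B \<delta> (x # y # zs) = bracket B \<delta> x (nested_bracket B \<delta> (y # zs))"

lemma Nplus_add: "k \<in> Nplus \<Longrightarrow> l \<in> Nplus \<Longrightarrow> k + l \<in> Nplus"
  by (auto simp: Nplus_def deg_def sum.distrib)

lemma deg_add: "deg (k + l) = deg k + deg l"
  by (simp add: deg_def sum.distrib)

lemma finite_splittings:
  "finite {(k, l). k \<in> Nplus \<and> l \<in> Nplus \<and> k + l = (n :: int ^ 'r::finite)}"
proof -
  have fin: "finite {k :: int ^ 'r. \<forall>i. k $ i \<in> {0..n $ i}}"
  proof (rule finite_subset)
    show "{k :: int ^ 'r. \<forall>i. k $ i \<in> {0..n $ i}} \<subseteq> vec_lambda ` (PiE UNIV (\<lambda>i. {0..n $ i}))"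
    proof
      fix k :: "int ^ 'r"
      assume "k \<in> {k. \<forall>i. k $ i \<in> {0..n $ i}}"
      then have "vec_nth k \<in> PiE UNIV (\<lambda>i. {0..n $ i})" by auto
      moreover have "k = vec_lambda (vec_nth k)" by simp
      ultimately show "k \<in> vec_lambda ` (PiE UNIV (\<lambda>i. {0..n $ i}))" by blast
    qed
    show "finite (vec_lambda ` (PiE UNIV (\<lambda>i. {0..n $ i})))"
      by (intro finite_imageI finite_PiE) auto
  qed
  show ?thesis
  proof (rule finite_subset)
    show "{(k, l). k \<in> Nplus \<and> l \<in> Nplus \<and> k + l = n}
        \<subseteq> {k. \<forall>i. k $ i \<in> {0..n $ i}} \<times> {k. \<forall>i. k $ i \<in> {0..n $ i}}"
      by (auto simp: Nplus_def)
  qed (use fin in blast)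
qed

lemma bracket_X:
  fixes n n' :: "int ^ 'r::finite"
  assumes "n \<in> Nplus" "n' \<in> Nplus"
  shows "bracket B \<delta> (X n) (X n') = (\<lambda>m. qnum \<delta> (B n n') * X (n + n') m)"
proof
  fix m :: "int ^ 'r"
  let ?S = "{(k, l). k \<in> Nplus \<and> l \<in> Nplus \<and> k + l = m}"
  have "bracket B \<delta> (X n) (X n') m =
      (\<Sum>p\<in>?S. if p = (n, n') then qnum \<delta> (B n n') else 0)"
    unfolding bracket_def by (rule sum.cong) (auto simp: X_def split: prod.splits)
  also have "\<dots> = (if (n, n') \<in> ?S then qnum \<delta> (B n n') else 0)"
    by (rule sum.delta[OF finite_splittings])
  finally show "bracket B \<delta> (X n) (X n') m = qnum \<delta> (B n n') * X (n + n') m"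
    using assms by (auto simp: X_def)
qed

lemma bracket_ghat: "bracket B \<delta> x y \<in> ghat"
proof -
  have "bracket B \<delta> x y n = 0" if "n \<notin> Nplus" for n
    unfolding bracket_def using that Nplus_add by (intro sum.neutral) blast
  then show ?thesis by (simp add: ghat_def)
qed

lemma nested_bracket_vanishes:
  assumes "set xs \<subseteq> ghat" and "deg n < int (length xs)"
  shows "nested_bracket B \<delta> xs n = 0"
  using assms
proof (induction xs arbitrary: n rule: nested_bracket.induct)
  case (1 B \<delta>)
  then show ?case by simp
next
  case (2 B \<delta> x)
  then show ?case by (auto simp: ghat_def Nplus_def)
next
  case (3 B \<delta> x y zs)
  have "x k * nested_bracket B \<delta> (y # zs) l * qnum \<delta> (B k l) = 0"
    if "k \<in> Nplus" "l \<in> Nplus" "k + l = n" for k l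
  proof -
    have "deg l < int (length (y # zs))"
      using that 3(3) by (auto simp: deg_add Nplus_def)
    then show ?thesis using 3 by simp
  qed
  then show ?case
    by (auto simp: bracket_def intro!: sum.neutral)
qed


text \<open>Dynkin's form of the Baker--Campbell--Hausdorff series, with right-nested brackets:
  \<open>log(e\<^sup>x e\<^sup>y) = \<Sum>\<^sub>k (-1)\<^bsup>k-1\<^esup>/k \<Sum> [x\<^bsup>r\<^sub>1\<^esup> y\<^bsup>s\<^sub>1\<^esup> \<dots> x\<^bsup>r\<^sub>k\<^esup> y\<^bsup>s\<^sub>k\<^esup>] / ((\<Sum>\<^sub>i (r\<^sub>i + s\<^sub>i)) \<Prod>\<^sub>i r\<^sub>i! s\<^sub>i!)\<close>,
  the inner sum being over all \<open>r\<^sub>i + s\<^sub>i > 0\<close>. The list \<open>ps\<close> is \<open>[(r\<^sub>1, s\<^sub>1), \<dots>, (r\<^sub>k, s\<^sub>k)]\<close>.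
  By \<open>nested_bracket_vanishes\<close>, only words of length at most \<open>deg n\<close> contribute to the
  coefficient of \<open>X\<^sub>n\<close>, so cutting the series off there loses nothing and makes the sum finite.\<close>

definition word :: "'r::finite coeffs \<Rightarrow> 'r coeffs \<Rightarrow> (nat \<times> nat) list \<Rightarrow> 'r coeffs list" where
  "word x y ps = concat (map (\<lambda>(r, s). replicate r x @ replicate s y) ps)"

definition word_length :: "(nat \<times> nat) list \<Rightarrow> nat" where
  "word_length ps = (\<Sum>(r, s) \<leftarrow> ps. r + s)"

definition dynkin_coeff :: "(nat \<times> nat) list \<Rightarrow> qfield" where
  "dynkin_coeff ps =
     (- 1) ^ (length ps - 1) / of_nat (length ps)
       / (of_nat (word_length ps) * (\<Prod>(r, s) \<leftarrow> ps. of_nat (fact r * fact s)))"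

definition bch ::
  "(int ^ 'r \<Rightarrow> int ^ 'r \<Rightarrow> rat) \<Rightarrow> ('r::finite \<Rightarrow> nat) \<Rightarrow> 'r coeffs \<Rightarrow> 'r coeffs \<Rightarrow> 'r coeffs" where
  "bch B \<delta> x y =
     (\<lambda>n. \<Sum>ps \<in> {ps. ps \<noteq> [] \<and> (\<forall>(r, s) \<in> set ps. r + s > 0) \<and> int (word_length ps) \<le> deg n}.
        dynkin_coeff ps * nested_bracket B \<delta> (word x y ps) n)"

lemma length_word: "length (word x y ps) = word_length ps"
  by (induction ps) (auto simp: word_def word_length_def)

lemma finite_dynkin_index:
  "finite {ps. ps \<noteq> [] \<and> (\<forall>(r, s) \<in> set ps. r + s > 0) \<and> int (word_length ps) \<le> d}"
proof (rule finite_subset)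
  let ?A = "{0..nat d} \<times> {0..nat d}"
  have *: "length ps \<le> word_length ps \<and> set ps \<subseteq> {0..word_length ps} \<times> {0..word_length ps}"
    if "\<forall>(r, s) \<in> set ps. r + s > 0" for ps
    using that by (induction ps) (fastforce simp: word_length_def)+
  show "{ps. ps \<noteq> [] \<and> (\<forall>(r, s) \<in> set ps. r + s > 0) \<and> int (word_length ps) \<le> d}
      \<subseteq> {ps. set ps \<subseteq> ?A \<and> length ps \<le> nat d}"
    using * by fastforce
  show "finite {ps. set ps \<subseteq> ?A \<and> length ps \<le> nat d}"
    by (rule finite_lists_length_le) auto
qed

datatype 'r formal_exp = Exp "('r::finite) coeffs"

fun Log :: "'r::finite formal_exp \<Rightarrow> 'r coeffs" where
  "Log (Exp x) = x"

definition G ::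
  "(int ^ 'r \<Rightarrow> int ^ 'r \<Rightarrow> rat) \<Rightarrow> ('r::finite \<Rightarrow> nat) \<Rightarrow> 'r formal_exp monoid" where
  "G B \<delta> = \<lparr> carrier = Exp ` ghat,
             mult = (\<lambda>g h. Exp (bch B \<delta> (Log g) (Log h))),
             one = Exp (\<lambda>_. 0) \<rparr>"

text \<open>The inner sum is over at most one index, since \<open>j \<mapsto> jn\<close> is injective for \<open>n \<in> Nplus\<close>.\<close>

definition Psi :: "('r::finite \<Rightarrow> nat) \<Rightarrow> rat \<Rightarrow> rat \<Rightarrow> int ^ 'r \<Rightarrow> 'r formal_exp" where
  "Psi \<delta> a b n = Exp (\<lambda>m. \<Sum>j | 1 \<le> j \<and> m = int j *s n.
     (- 1) ^ (j + 1) / (of_nat j * qnum \<delta> (of_nat j * a)) * qpow \<delta> (of_nat j * b))"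

lemma Psi_in_G: "n \<in> Nplus \<Longrightarrow> Psi \<delta> a b n \<in> carrier (G B \<delta>)"
proof -
  assume n: "n \<in> Nplus"
  have "int j *s n \<in> Nplus" if "1 \<le> j" for j
    using n that by (auto simp: Nplus_def deg_def simp flip: sum_distrib_left)
  then show ?thesis
    by (auto simp: Psi_def G_def ghat_def intro!: imageI sum.neutral)
qed

end

theory Submission
  imports Defs "HOL-Computational_Algebra.Formal_Power_Series"
begin

text \<open>The Lie algebra embeds into an associative algebra of twisted power series with basis \<open>Y\<^sub>n\<close> and
  \<open>Y\<^sub>m Y\<^sub>n = q\<^bsup>{m,n}\<^esup> Y\<^bsub>m+n\<^esub>\<close>, via \<open>X\<^sub>n \<mapsto> Y\<^sub>n / (q - q\<^bsup>-1\<^esup>)\<close>. There the Baker--Campbell--Hausdorff product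
  becomes \<open>e\<^sup>x e\<^sup>y\<close>: in noncommutative power series in \<open>x\<close> and \<open>y\<close>, put \<open>U = e\<^sup>x e\<^sup>y\<close> and let \<open>D\<close> be the derivation
  multiplying words by their length. Then
  \<open>D (ln U) = \<Sum>\<^sub>l (-1)\<^sup>l/(l+1) (Ad U - 1)\<^sup>l (x + e\<^bsup>ad x\<^esup> y)\<close>, and expanding \<open>Ad U = e\<^bsup>ad x\<^esup> e\<^bsup>ad y\<^esup>\<close> gives Dynkin's
  series.

  Exponentiating, \<open>\<Psi>\<close> becomes the series \<open>E\<close> with \<open>E(pu) = (1 + u) E(u/p)\<close>, \<open>p = q\<^sup>a\<close>, that is
  \<open>E(u) = \<Sum>\<^sub>k (-p)\<^sup>k u\<^sup>k / (p\<^sup>2; p\<^sup>2)\<^sub>k\<close>. The pentagon relation is then a comparison of the coefficients of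
  \<open>Y\<close> at \<open>a n\<^sub>1 + b n\<^sub>2\<close>, which is a terminating \<open>q\<close>-binomial identity.\<close>

text \<open>The detour through free letters is forced by the derivation D. Dynkin's coefficients
  contain 1/(word length), and an element of the twisted algebra does not remember the lengths of
  the words it came from, since x and y are themselves infinite sums over many degrees. For free
  letters the word length is a grading, so D exists and multiplying by the length removes that
  denominator. Substituting x and y for the letters carries the result over; it makes sense because
  neither has a term in degree 0. The formula for D (ln U) arises as follows. With P = U - 1, a
  Taylor expansion of ln at P, in which all powers of P are moved to the right, has the terms
  (-1)^l/(l+1) (ad P)^l (D U) U^(-l-1). Since [P, g] U^(-1) = (Ad U - 1) g, each ad P together with
  one factor U^(-1) becomes Ad U - 1, and the last U^(-1) turns D U into (D U) U^(-1) = x + e^(ad x)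
  y. Two elements of G with the same exponential are equal because ln recovers the exponent;
  characteristic 0 is what makes exp, ln and the division by lengths available.\<close>

instance fract :: ("{idom,ring_char_0}") field_char_0
proof
  show "inj (of_nat :: nat \<Rightarrow> 'a fract)"
    by (rule injI) (simp add: of_nat_fract eq_fract)
qed

section \<open>Noncommutative power series\<close>

text \<open>A type of its own rather than a synonym, so that it can be made a ring and inherit
  powers and finite sums.\<close>

typedef ('a, 'k) ncps = "UNIV :: ('a list \<Rightarrow> 'k) set"
  morphisms nth_ncps Abs_ncps ..

lemma nth_Abs_ncps [simp]: "nth_ncps (Abs_ncps f) w = f w"
  by (simp add: Abs_ncps_inverse)

lemma ncps_eqI: "(\<And>w. nth_ncps f w = nth_ncps g w) \<Longrightarrow> f = g"
  by (metis ext nth_ncps_inject)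

text \<open>The Cauchy product over all ways to cut the word into a prefix and a suffix: either the
  prefix is empty, or it starts with the first letter.\<close>

primrec conv :: "('a list \<Rightarrow> 'k::semiring_0) \<Rightarrow> ('a list \<Rightarrow> 'k) \<Rightarrow> 'a list \<Rightarrow> 'k" where
  "conv f g [] = f [] * g []"
| "conv f g (c # w) = f [] * g (c # w) + conv (\<lambda>v. f (c # v)) g w"

lemma conv_add_left: "conv (\<lambda>v. f v + g v) h w = conv f h w + conv g h w"
  by (induction w arbitrary: f g h) (simp_all add: algebra_simps)

lemma conv_add_right: "conv f (\<lambda>v. g v + h v) w = conv f g w + conv f h w"
  by (induction w arbitrary: f) (simp_all add: algebra_simps)

lemma conv_scale_left: "conv (\<lambda>v. k * f v) g w = k * conv f g w"
  by (induction w arbitrary: f) (simp_all add: algebra_simps)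

lemma conv_scale_right:
  fixes k :: "'k::comm_semiring_0"
  shows "conv f (\<lambda>v. k * g v) w = k * conv f g w"
  by (induction w arbitrary: f) (simp_all add: algebra_simps)

lemma conv_assoc: "conv (conv f g) h w = conv f (conv g h) w"
proof (induction w arbitrary: f g)
  case (Cons c w)
  have "conv f g = (\<lambda>v. conv f g v)" by simp
  then show ?case
    by (simp add: conv_add_left conv_scale_left Cons.IH algebra_simps)
qed (simp add: mult.assoc)

lemma conv_zero_left [simp]: "conv (\<lambda>_. 0) g w = 0"
  by (induction w) simp_all

lemma conv_one_left: "conv (\<lambda>v. if v = [] then 1 else 0) (g :: _ \<Rightarrow> 'k::semiring_1) w = g w"
  by (cases w) simp_all

lemma conv_one_right: "conv (g :: _ \<Rightarrow> 'k::semiring_1) (\<lambda>v. if v = [] then 1 else 0) w = g w"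
  by (induction w arbitrary: g) simp_all

instantiation ncps :: (type, comm_ring_1) ring_1
begin

definition "0 = Abs_ncps (\<lambda>_. 0)"
definition "1 = Abs_ncps (\<lambda>v. if v = [] then 1 else 0)"
definition "f + g = Abs_ncps (\<lambda>w. nth_ncps f w + nth_ncps g w)"
definition "f - g = Abs_ncps (\<lambda>w. nth_ncps f w - nth_ncps g w)"
definition "- f = Abs_ncps (\<lambda>w. - nth_ncps f w)"
definition "f * g = Abs_ncps (conv (nth_ncps f) (nth_ncps g))"

lemmas ncps_ops = zero_ncps_def one_ncps_def plus_ncps_def minus_ncps_def uminus_ncps_def times_ncps_def

instance
proof
  fix a b c :: "('a, 'b) ncps"
  have eta: "nth_ncps (Abs_ncps f) = f" for f :: "'a list \<Rightarrow> 'b"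
    by (simp add: Abs_ncps_inverse)
  show "a * b * c = a * (b * c)"
    by (rule ncps_eqI) (simp add: times_ncps_def conv_assoc eta)
  show "(a + b) * c = a * c + b * c" "a * (b + c) = a * b + a * c"
    by (rule ncps_eqI, simp add: ncps_ops conv_add_left conv_add_right eta)+
  show "1 * a = a" "a * 1 = a"
    by (rule ncps_eqI, simp add: ncps_ops conv_one_left conv_one_right eta)+
  show "(0 :: ('a, 'b) ncps) \<noteq> 1"
  proof
    assume "(0 :: ('a, 'b) ncps) = 1"
    then have "nth_ncps (0 :: ('a, 'b) ncps) [] = nth_ncps (1 :: ('a, 'b) ncps) []" by (rule arg_cong)
    then show False by (simp add: ncps_ops)
  qed
qed (rule ncps_eqI, simp add: ncps_ops algebra_simps)+

end

lemma nth_ncps_simps [simp]: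
  "nth_ncps 0 w = 0"
  "nth_ncps 1 w = (if w = [] then 1 else 0)"
  "nth_ncps (f + g) w = nth_ncps f w + nth_ncps g w"
  "nth_ncps (f - g) w = nth_ncps f w - nth_ncps g w"
  "nth_ncps (- f) w = - nth_ncps f w"
  by (simp_all add: ncps_ops)

lemma nth_ncps_sum [simp]: "nth_ncps (sum F I) w = (\<Sum>i\<in>I. nth_ncps (F i) w)"
  by (induction I rule: infinite_finite_induct) simp_all

text \<open>Left quotient by a letter: over a finite alphabet, \<open>f\<close> is its constant term
  plus the sum of \<open>letter c * ncps_shift c f\<close>. This decomposition drives the inductions
  on words and the evaluation of a series.\<close>

definition ncps_shift :: "'a \<Rightarrow> ('a, 'k) ncps \<Rightarrow> ('a, 'k) ncps" where
  "ncps_shift c f = Abs_ncps (\<lambda>v. nth_ncps f (c # v))"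

lemma nth_ncps_shift [simp]: "nth_ncps (ncps_shift c f) w = nth_ncps f (c # w)"
  by (simp add: ncps_shift_def)

lemma nth_ncps_mult:
  "nth_ncps (f * g) [] = nth_ncps f [] * nth_ncps g []"
  "nth_ncps (f * g) (c # w) = nth_ncps f [] * nth_ncps g (c # w) + nth_ncps (ncps_shift c f * g) w"
  by (simp_all add: times_ncps_def ncps_shift_def Abs_ncps_inverse)

definition scl :: "'k::comm_ring_1 \<Rightarrow> ('a, 'k) ncps \<Rightarrow> ('a, 'k) ncps" where
  "scl k f = Abs_ncps (\<lambda>w. k * nth_ncps f w)"

lemma nth_ncps_scl [simp]: "nth_ncps (scl k f) w = k * nth_ncps f w"
  by (simp add: scl_def)

lemma scl_simps [simp]:
  "scl k f * g = scl k (f * g)" "f * scl k g = scl k (f * g)"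
  "scl k (scl l f) = scl (k * l) f" "scl 1 f = f" "scl 0 f = 0" "scl k 0 = 0"
  by (rule ncps_eqI,
      simp add: times_ncps_def scl_def Abs_ncps_inverse conv_scale_left conv_scale_right mult.assoc)+

lemma scl_add: "scl k (f + g) = scl k f + scl k g" "scl (k + l) f = scl k f + scl l f"
  "scl k (f - g) = scl k f - scl k g" "scl (- k) f = - scl k f"
  by (rule ncps_eqI, simp add: algebra_simps)+

lemma scl_sum: "scl k (sum F I) = (\<Sum>i\<in>I. scl k (F i))" "scl (sum u I) f = (\<Sum>i\<in>I. scl (u i) f)"
  by (rule ncps_eqI, simp add: sum_distrib_left sum_distrib_right)+

definition letter :: "'a \<Rightarrow> ('a, 'k::comm_ring_1) ncps" where
  "letter c = Abs_ncps (\<lambda>w. if w = [c] then 1 else 0)"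

lemma nth_letter: "nth_ncps (letter c) w = (if w = [c] then 1 else 0)"
  by (simp add: letter_def)

lemma ncps_shift_linear:
  "ncps_shift c (f + g) = ncps_shift c f + ncps_shift c g"
  "ncps_shift c (scl k f) = scl k (ncps_shift c f)"
  "ncps_shift c (0 :: ('a, 'k::comm_ring_1) ncps) = 0"
  "ncps_shift c (1 :: ('a, 'k::comm_ring_1) ncps) = 0"
  by (rule ncps_eqI, simp)+

lemma ncps_shift_mult: "ncps_shift c (f * g) = scl (nth_ncps f []) (ncps_shift c g)
    + ncps_shift c f * g"
  by (rule ncps_eqI) (simp add: nth_ncps_mult)


subsection \<open>Order and infinite sums\<close>

text \<open>Takes the place of a topology: infinite sums are compared through their truncations, one
  length bound at a time.\<close>

definition agree :: "nat \<Rightarrow> ('a, 'k) ncps \<Rightarrow> ('a, 'k) ncps \<Rightarrow> bool" where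
  "agree d f g \<longleftrightarrow> (\<forall>w. length w \<le> d \<longrightarrow> nth_ncps f w = nth_ncps g w)"

lemma agreeD: "agree d f g \<Longrightarrow> length w \<le> d \<Longrightarrow> nth_ncps f w = nth_ncps g w"
  by (simp add: agree_def)

lemma agree_refl [simp]: "agree d f f"
  by (simp add: agree_def)

lemma agree_sym: "agree d f g \<Longrightarrow> agree d g f"
  by (simp add: agree_def)

lemma agree_trans [trans]: "agree d f g \<Longrightarrow> agree d g h \<Longrightarrow> agree d f h"
  by (simp add: agree_def)

lemma agree_eqI: "(\<And>d. agree d f g) \<Longrightarrow> f = g"
  by (rule ncps_eqI) (auto simp: agree_def)

lemma agree_arith:
  "agree d f f' \<Longrightarrow> agree d g g' \<Longrightarrow> agree d (f + g) (f' + g')"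
  "agree d f f' \<Longrightarrow> agree d g g' \<Longrightarrow> agree d (f - g) (f' - g')"
  "agree d f f' \<Longrightarrow> agree d (scl k f) (scl k f')"
  by (simp_all add: agree_def)

lemma agree_sum: "(\<And>i. i \<in> I \<Longrightarrow> agree d (F i) (H i)) \<Longrightarrow> agree d (sum F I) (sum H I)"
  by (simp add: agree_def)

lemma agree_mult:
  assumes "agree d f f'" "agree d g g'"
  shows "agree d (f * g) (f' * g')"
proof -
  have "nth_ncps (f * g) w = nth_ncps (f' * g') w"
    if "agree d f f'" "agree d g g'" "length w \<le> d" for w
    using that
  proof (induction w arbitrary: f f' d)
    case Nil
    then show ?case by (simp add: nth_ncps_mult agree_def)
  next
    case (Cons c w)
    have *: "agree (length w) (ncps_shift c f) (ncps_shift c f')" "agree (length w) g g'"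
      using Cons.prems by (simp_all add: agree_def)
    show ?case
      using Cons.prems Cons.IH[OF *] by (simp add: nth_ncps_mult agree_def)
  qed
  then show ?thesis using assms by (simp add: agree_def)
qed

definition ord_ge :: "nat \<Rightarrow> ('a, 'k::zero) ncps \<Rightarrow> bool" where
  "ord_ge d f \<longleftrightarrow> (\<forall>w. length w < d \<longrightarrow> nth_ncps f w = 0)"

lemma ord_ge_0 [simp]: "ord_ge 0 f"
  by (simp add: ord_ge_def)

lemma ord_ge_1: "ord_ge (Suc 0) f \<longleftrightarrow> nth_ncps f [] = 0"
  by (simp add: ord_ge_def)

lemma ord_geD: "ord_ge d f \<Longrightarrow> length w < d \<Longrightarrow> nth_ncps f w = 0"
  by (simp add: ord_ge_def)

lemma ord_ge_mono: "ord_ge d f \<Longrightarrow> e \<le> d \<Longrightarrow> ord_ge e f"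
  by (simp add: ord_ge_def)

lemma ord_ge_mult:
  assumes "ord_ge a f" "ord_ge b g"
  shows "ord_ge (a + b) (f * g)"
proof -
  have "nth_ncps (f * g) w = 0" if "ord_ge a f" "length w < a + b" for w
    using that
  proof (induction w arbitrary: f a)
    case Nil
    then show ?case using assms(2) by (cases a) (auto simp: nth_ncps_mult ord_ge_def)
  next
    case (Cons c w)
    have "ord_ge (a - 1) (ncps_shift c f)"
      using Cons.prems(1) by (auto simp: ord_ge_def)
    moreover have "length w < (a - 1) + b"
      using Cons.prems(2) by auto
    ultimately have "nth_ncps (ncps_shift c f * g) w = 0"
      by (rule Cons.IH)
    moreover have "nth_ncps f [] * nth_ncps g (c # w) = 0"
      using Cons.prems assms(2) by (cases a) (auto simp: ord_ge_def)
    ultimately show ?case by (simp only: nth_ncps_mult add_0)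
  qed
  then show ?thesis using assms by (simp add: ord_ge_def)
qed

lemma ord_ge_arith:
  "ord_ge d f \<Longrightarrow> ord_ge d g \<Longrightarrow> ord_ge d (f + g :: ('a, 'k::comm_ring_1) ncps)"
  "ord_ge d f \<Longrightarrow> ord_ge d g \<Longrightarrow> ord_ge d (f - g :: ('a, 'k::comm_ring_1) ncps)"
  "ord_ge d f \<Longrightarrow> ord_ge d (scl k f)"
  by (simp_all add: ord_ge_def)

lemma ord_ge_sum: "(\<And>i. i \<in> I \<Longrightarrow> ord_ge d (F i)) \<Longrightarrow> ord_ge d (sum F I :: ('a, 'k::comm_ring_1) ncps)"
  by (simp add: ord_ge_def)

lemma ord_ge_power: "nth_ncps f [] = 0 \<Longrightarrow> ord_ge k (f ^ k)"
proof (induction k)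
  case (Suc k)
  then show ?case using ord_ge_mult[of "Suc 0" f k "f ^ k"] by (simp add: ord_ge_1)
qed simp

definition graded :: "(nat \<Rightarrow> ('a, 'k::zero) ncps) \<Rightarrow> bool" where
  "graded F \<longleftrightarrow> (\<forall>k. ord_ge k (F k))"

text \<open>The cutoff loses nothing for \<open>graded\<close> families, whose \<open>k\<close>-th
  member has no words shorter than \<open>k\<close>.\<close>

definition nsum :: "(nat \<Rightarrow> ('a, 'k::comm_ring_1) ncps) \<Rightarrow> ('a, 'k) ncps" where
  "nsum F = Abs_ncps (\<lambda>w. \<Sum>k\<le>length w. nth_ncps (F k) w)"

lemma nth_nsum:
  assumes "graded F" "length w \<le> d"
  shows "nth_ncps (nsum F) w = (\<Sum>k\<le>d. nth_ncps (F k) w)"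
proof -
  have "(\<Sum>k\<le>length w. nth_ncps (F k) w) = (\<Sum>k\<le>d. nth_ncps (F k) w)"
    using assms by (intro sum.mono_neutral_left) (auto simp: graded_def ord_ge_def)
  then show ?thesis by (simp add: nsum_def)
qed

lemma agree_nsum: "graded F \<Longrightarrow> agree d (nsum F) (\<Sum>k\<le>d. F k)"
  by (simp add: agree_def nth_nsum)

lemma nsum_mult:
  assumes F: "graded F" and H: "graded H"
  shows "nsum F * nsum H = nsum (\<lambda>n. \<Sum>i\<le>n. F i * H (n - i))"
proof (rule agree_eqI)
  fix d
  have ord: "ord_ge (i + j) (F i * H j)" for i j
    using F H by (simp add: graded_def ord_ge_mult)
  have gr: "graded (\<lambda>n. \<Sum>i\<le>n. F i * H (n - i))"
    unfolding graded_def
  proof (intro allI ord_ge_sum)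
    fix n i :: nat
    assume "i \<in> {..n}"
    then show "ord_ge n (F i * H (n - i))" using ord[of i "n - i"] by simp
  qed
  have "agree d (nsum F * nsum H) ((\<Sum>i\<le>d. F i) * (\<Sum>j\<le>d. H j))"
    by (intro agree_mult agree_nsum F H)
  also have "(\<Sum>i\<le>d. F i) * (\<Sum>j\<le>d. H j) = (\<Sum>(i, j)\<in>{..d} \<times> {..d}. F i * H j)"
    by (simp add: sum_product sum.cartesian_product)
  \<comment> \<open>From the square to the triangle: pairs with \<open>i + j > d\<close> contribute
    only words longer than \<open>d\<close>.\<close>
  also have "agree d \<dots> (\<Sum>(i, j)\<in>{(i, j). i + j \<le> d}. F i * H j)"
    unfolding agree_def nth_ncps_sum
    by (intro allI impI sum.mono_neutral_right)
      (auto simp: case_prod_unfold intro!: ord_geD[OF ord])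
  also have "(\<Sum>(i, j)\<in>{(i, j). i + j \<le> d}. F i * H j) = (\<Sum>n\<le>d. \<Sum>i\<le>n. F i * H (n - i))"
    by (rule sum.triangle_reindex_eq)
  also have "agree d \<dots> (nsum (\<lambda>n. \<Sum>i\<le>n. F i * H (n - i)))"
    by (intro agree_sym[OF agree_nsum] gr)
  finally show "agree d (nsum F * nsum H) (nsum (\<lambda>n. \<Sum>i\<le>n. F i * H (n - i)))" .
qed

lemma nsum_mult_right:
  assumes "graded F"
  shows "nsum F * g = nsum (\<lambda>k. F k * g)"
proof (rule agree_eqI)
  fix d
  have gr: "graded (\<lambda>k. F k * g)"
    unfolding graded_def
  proof
    fix k
    show "ord_ge k (F k * g)"
      using ord_ge_mult[of k "F k" 0 g] assms by (simp add: graded_def)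
  qed
  have "agree d (nsum F * g) ((\<Sum>k\<le>d. F k) * g)"
    by (intro agree_mult agree_nsum assms agree_refl)
  also have "\<dots> = (\<Sum>k\<le>d. F k * g)" by (rule sum_distrib_right)
  also have "agree d \<dots> (nsum (\<lambda>k. F k * g))"
    by (intro agree_sym[OF agree_nsum] gr)
  finally show "agree d (nsum F * g) (nsum (\<lambda>k. F k * g))" .
qed


subsection \<open>Substitution into a univariate power series\<close>

definition subst :: "('a, 'k::comm_ring_1) ncps \<Rightarrow> 'k fps \<Rightarrow> ('a, 'k) ncps" where
  "subst P F = nsum (\<lambda>k. scl (fps_nth F k) (P ^ k))"

lemma graded_subst: "nth_ncps P [] = 0 \<Longrightarrow> graded (\<lambda>k. scl (u k) (P ^ k))"
  by (simp add: graded_def ord_ge_arith ord_ge_power)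

lemma agree_subst:
  "nth_ncps P [] = 0 \<Longrightarrow> agree d (subst P F) (\<Sum>k\<le>d. scl (fps_nth F k) (P ^ k))"
  unfolding subst_def by (intro agree_nsum graded_subst)

lemma subst_mult: "nth_ncps P [] = 0 \<Longrightarrow> subst P (F * H) = subst P F * subst P H"
  unfolding subst_def
  by (simp add: nsum_mult graded_subst fps_mult_nth atLeast0AtMost scl_sum mult.commute flip: power_add)

lemma subst_add: "subst P (F + H) = subst P F + subst P H"
  unfolding subst_def nsum_def by (rule ncps_eqI) (simp add: sum.distrib algebra_simps)

lemma subst_fps_const: "subst P (fps_const k) = scl k 1"
  unfolding subst_def nsum_def
  by (rule ncps_eqI) (simp add: if_distrib[of "\<lambda>u. u * _"] cong: if_cong)

lemma subst_1: "subst P 1 = 1"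
  using subst_fps_const[of P 1] by simp

lemma subst_fps_X: "nth_ncps P [] = 0 \<Longrightarrow> subst P fps_X = P"
  unfolding subst_def nsum_def
  by (rule ncps_eqI) (auto simp: if_distrib[of "\<lambda>u. u * _"] Suc_le_eq cong: if_cong)

lemma subst_power: "nth_ncps P [] = 0 \<Longrightarrow> subst P (F ^ k) = subst P F ^ k"
  by (induction k) (simp_all add: subst_1 subst_mult)

lemma nth_subst_Nil: "nth_ncps (subst P F) [] = fps_nth F 0"
  by (simp add: subst_def nsum_def)

lemma subst_compose:
  assumes P: "nth_ncps P [] = 0" and F: "fps_nth F 0 = 0"
  shows "subst (subst P F) H = subst P (H oo F)"
proof (rule agree_eqI)
  fix d
  have "agree d (subst (subst P F) H) (\<Sum>k\<le>d. scl (fps_nth H k) (subst P F ^ k))"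
    by (intro agree_subst) (simp add: nth_subst_Nil F)
  also have "\<dots> = (\<Sum>k\<le>d. scl (fps_nth H k) (subst P (F ^ k)))"
    by (simp add: subst_power P)
  also have "agree d \<dots> (\<Sum>k\<le>d. scl (fps_nth H k) (\<Sum>n\<le>d. scl (fps_nth (F ^ k) n) (P ^ n)))"
    by (intro agree_sum agree_arith agree_subst P)
  also have "\<dots> = (\<Sum>n\<le>d. scl (\<Sum>k\<le>d. fps_nth H k * fps_nth (F ^ k) n) (P ^ n))"
    unfolding scl_sum scl_simps by (rule sum.swap)
  \<comment> \<open>The composition sums over k \<le> n only; the terms with n < k \<le> d vanish
    because \<open>F ^ k\<close> starts in degree \<open>k\<close>.\<close>
  also have "\<dots> = (\<Sum>n\<le>d. scl (fps_nth (H oo F) n) (P ^ n))"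
  proof (intro sum.cong refl arg_cong2[of _ _ _ _ scl])
    fix n assume "n \<in> {..d}"
    then show "(\<Sum>k\<le>d. fps_nth H k * fps_nth (F ^ k) n) = fps_nth (H oo F) n"
      unfolding fps_compose_nth atLeast0AtMost
      by (intro sum.mono_neutral_right) (auto simp: startsby_zero_power_prefix F)
  qed
  also have "agree d \<dots> (subst P (H oo F))"
    by (intro agree_sym[OF agree_subst] P)
  finally show "agree d (subst (subst P F) H) (subst P (H oo F))" .
qed


subsection \<open>The Euler derivation\<close>

definition euler :: "('a, 'k::comm_ring_1) ncps \<Rightarrow> ('a, 'k) ncps" where
  "euler f = Abs_ncps (\<lambda>w. of_nat (length w) * nth_ncps f w)"

lemma nth_euler [simp]: "nth_ncps (euler f) w = of_nat (length w) * nth_ncps f w"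
  by (simp add: euler_def)

lemma euler_simps [simp]:
  "euler (f + g) = euler f + euler g" "euler (f - g) = euler f - euler g"
  "euler (scl k f) = scl k (euler f)" "euler 0 = 0" "euler 1 = 0" "euler (letter c) = letter c"
  by (rule ncps_eqI, simp add: algebra_simps nth_letter)+

lemma euler_sum: "euler (sum F I) = (\<Sum>i\<in>I. euler (F i))"
  by (rule ncps_eqI) (simp add: sum_distrib_left)

lemma euler_mult: "euler (f * g) = euler f * g + f * euler g"
proof (rule ncps_eqI)
  fix w
  show "nth_ncps (euler (f * g)) w = nth_ncps (euler f * g + f * euler g) w"
  proof (induction w arbitrary: f)
    case Nil
    then show ?case by (simp add: nth_ncps_mult)
  next
    case (Cons c w)
    have sh: "ncps_shift c (euler f) = euler (ncps_shift c f) + ncps_shift c f"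
      by (rule ncps_eqI) (simp add: algebra_simps)
    show ?case
      using Cons.IH[of "ncps_shift c f"] by (simp add: nth_ncps_mult sh algebra_simps)
  qed
qed

lemma agree_euler: "agree d f g \<Longrightarrow> agree d (euler f) (euler g)"
  by (simp add: agree_def)

text \<open>The \<open>k\<close>-th power of a letter is homogeneous of length \<open>k\<close>, so
  on series in one letter the derivation is X d/dX.\<close>

lemma euler_subst_letter: "euler (subst (letter c) F) = subst (letter c) (fps_X * fps_deriv F)"
proof -
  have "euler (letter c ^ k) = scl (of_nat k) (letter c ^ k :: ('a, 'k::comm_ring_1) ncps)"
    for c :: 'a and k
    by (induction k) (simp_all add: euler_mult scl_add)
  then have *: "of_nat (length w) * nth_ncps (letter c ^ k) w = of_nat k * nth_ncps (letter c ^ k) w"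
    for c :: 'a and k and w and x :: "'k::comm_ring_1"
    by (metis nth_euler nth_ncps_scl)
  show ?thesis
  proof (rule ncps_eqI)
    fix w :: "'a list"
    have "of_nat (length w) * (fps_nth F k * nth_ncps (letter c ^ k) w)
        = fps_nth (fps_X * fps_deriv F) k * nth_ncps (letter c ^ k) w" for k
      using arg_cong[OF *[of w c k], of "\<lambda>x. fps_nth F k * x"]
      by (cases k) (simp_all add: algebra_simps)
    then show "nth_ncps (euler (subst (letter c) F)) w
        = nth_ncps (subst (letter c) (fps_X * fps_deriv F)) w"
      by (simp add: subst_def nsum_def sum_distrib_left del: fps_X_mult_nth)
  qed
qed


subsection \<open>Commutators\<close>

definition commutator :: "'a::ring \<Rightarrow> 'a \<Rightarrow> 'a" where
  "commutator a b = a * b - b * a"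

lemma agree_commutator: "agree d f f' \<Longrightarrow> agree d g g' \<Longrightarrow> agree d (commutator f g) (commutator f' g')"
  by (simp add: commutator_def agree_arith agree_mult)

lemma agree_ad_power: "agree d g g' \<Longrightarrow> agree d ((commutator f ^^ r) g) ((commutator f ^^ r) g')"
  by (induction r) (simp_all add: agree_commutator)

lemma commutator_linear:
  "commutator f (g + h) = commutator f g + commutator f h"
  "commutator f (scl k g) = scl k (commutator f g)"
  "commutator f (sum F I) = (\<Sum>i\<in>I. commutator f (F i))"
  by (simp_all add: commutator_def algebra_simps scl_add sum_distrib_left sum_distrib_right sum_subtractf)

lemma ad_power_linear:
  "(commutator f ^^ r) (scl k g) = scl k ((commutator f ^^ r) g)"
  "(commutator f ^^ r) (sum F I) = (\<Sum>i\<in>I. (commutator f ^^ r) (F i))"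
  by (induction r) (simp_all add: commutator_linear)

lemma ord_ge_commutator:
  assumes "nth_ncps f [] = 0" "ord_ge d g"
  shows "ord_ge (Suc d) (commutator f g)"
  using assms ord_ge_mult[of 1 f d g] ord_ge_mult[of d g 1 f]
  by (auto simp: commutator_def ord_ge_1 intro!: ord_ge_arith)

lemma ord_ge_ad_power:
  assumes "nth_ncps f [] = 0" "ord_ge d g"
  shows "ord_ge (r + d) ((commutator f ^^ r) g)"
  using assms by (induction r) (auto intro: ord_ge_commutator)

text \<open>Pascal's rule, summed; the induction step for the binomial formula below.\<close>

lemma sum_scl_choose_Suc:
  "(\<Sum>i\<le>Suc r. scl (of_nat (Suc r choose i)) (h i))
     = (\<Sum>i\<le>r. scl (of_nat (r choose i)) (h (Suc i) + h i))"
proof -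
  let ?C = "\<lambda>i. scl (of_nat (r choose i))"
  have "(\<Sum>i\<le>Suc r. scl (of_nat (Suc r choose i)) (h i))
      = (\<Sum>i\<le>r. ?C i (h (Suc i))) + (h 0 + (\<Sum>i\<le>r. ?C (Suc i) (h (Suc i))))"
    by (subst sum.atMost_Suc_shift) (simp add: scl_add sum.distrib add_ac)
  also have "h 0 + (\<Sum>i\<le>r. ?C (Suc i) (h (Suc i))) = (\<Sum>i\<le>Suc r. ?C i (h i))"
    by (subst sum.atMost_Suc_shift) simp
  also have "\<dots> = (\<Sum>i\<le>r. ?C i (h i))"
    by (simp add: binomial_eq_0)
  finally show ?thesis by (simp add: scl_add sum.distrib)
qed

text \<open>The commutator with \<open>a\<close> is left minus right multiplication by
  \<open>a\<close>. These two commute, so the binomial theorem applies.\<close>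

lemma ad_power_binomial:
  fixes a g :: "('a, 'k::comm_ring_1) ncps"
  shows "(commutator a ^^ r) g =
    (\<Sum>i\<le>r. scl (of_nat (r choose i)) (scl ((-1) ^ (r - i)) (a ^ i * g * a ^ (r - i))))"
proof (induction r)
  case (Suc r)
  let ?h = "\<lambda>i. scl ((-1) ^ (Suc r - i)) (a ^ i * g * a ^ (Suc r - i))"
  have "commutator a (scl ((-1) ^ (r - i)) (a ^ i * g * a ^ (r - i))) = ?h (Suc i) + ?h i"
    if "i \<le> r" for i
    using that
    by (simp add: commutator_def Suc_diff_le scl_add mult.assoc power_commutes)
  moreover have "(commutator a ^^ Suc r) g = (\<Sum>i\<le>r. scl (of_nat (r choose i))
      (commutator a (scl ((-1) ^ (r - i)) (a ^ i * g * a ^ (r - i)))))"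
    by (simp only: funpow.simps o_apply Suc commutator_linear)
  ultimately show ?case
    unfolding sum_scl_choose_Suc by simp
qed simp

text \<open>Ad e^a = e^(ad a): dividing the binomial formula by r! turns it into the Cauchy product
  of the two exponential series.\<close>

lemma exp_conjugation:
  fixes a g :: "('a, 'k::field_char_0) ncps"
  assumes a: "nth_ncps a [] = 0"
  shows "subst a (fps_exp 1) * g * subst a (fps_exp (- 1))
    = nsum (\<lambda>r. scl (1 / fact r) ((commutator a ^^ r) g))"
proof -
  have ord: "ord_ge k (a ^ k * g)" for k
    using ord_ge_mult[OF ord_ge_power[OF a, of k], of 0 g] by simp
  have "subst a (fps_exp 1) * g * subst a (fps_exp (- 1))
      = nsum (\<lambda>k. scl (1 / fact k) (a ^ k * g)) * nsum (\<lambda>k. scl ((- 1) ^ k / fact k) (a ^ k))"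
    by (simp add: subst_def nsum_mult_right graded_subst a)
  also have "\<dots> = nsum (\<lambda>r. \<Sum>i\<le>r. scl (1 / fact i) (a ^ i * g)
      * scl ((- 1) ^ (r - i) / fact (r - i)) (a ^ (r - i)))"
    by (intro nsum_mult graded_subst a) (simp add: graded_def ord ord_ge_arith)
  also have "\<dots> = nsum (\<lambda>r. scl (1 / fact r) ((commutator a ^^ r) g))"
    unfolding ad_power_binomial scl_sum
    by (intro arg_cong[of _ _ nsum] ext sum.cong refl)
      (simp add: binomial_fact, simp add: field_simps)
  finally show ?thesis .
qed

text \<open>The product rule leaves powers of \<open>P\<close> on both sides of
  \<open>euler P\<close>. Those on the left are moved to the right by P g = [P, g] + g P, and the
  resulting binomial coefficients add up by Pascal's rule.\<close>

lemma euler_power: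
  "euler (P ^ k) = (\<Sum>l<k. scl (of_nat (k choose Suc l)) ((commutator P ^^ l) (euler P)
      * P ^ (k - Suc l)))"
proof (induction k)
  case (Suc k)
  let ?f = "\<lambda>l. (commutator P ^^ l) (euler P)"
  have 1: "P * ?f l = ?f (Suc l) + ?f l * P" for l
    by (simp add: commutator_def)
  have 2: "P * (?f l * P ^ (k - Suc l)) = ?f (Suc l) * P ^ (k - Suc l) + ?f l * P ^ (k - l)"
    if "l < k" for l
    using that by (simp add: mult.assoc[symmetric] 1 distrib_right)
      (simp add: mult.assoc power_Suc[symmetric] Suc_diff_Suc del: power_Suc)
  have "euler (P ^ Suc k) = ?f 0 * P ^ k + (\<Sum>l<k. scl (of_nat (k choose Suc l)) (?f (Suc l)
      * P ^ (k - Suc l)))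
      + (\<Sum>l<k. scl (of_nat (k choose Suc l)) (?f l * P ^ (k - l)))"
    by (simp add: euler_mult Suc.IH sum_distrib_left 2 scl_add sum.distrib add.assoc)
  also have "?f 0 * P ^ k + (\<Sum>l<k. scl (of_nat (k choose Suc l)) (?f (Suc l) * P ^ (k - Suc l)))
      = (\<Sum>l<Suc k. scl (of_nat (k choose l)) (?f l * P ^ (k - l)))"
    by (subst sum.lessThan_Suc_shift) simp
  also have "(\<Sum>l<k. scl (of_nat (k choose Suc l)) (?f l * P ^ (k - l)))
      = (\<Sum>l<Suc k. scl (of_nat (k choose Suc l)) (?f l * P ^ (k - l)))"
    by (simp add: binomial_eq_0)
  finally show ?case
    by (simp add: sum.distrib[symmetric] scl_add(2)[symmetric] del: sum.lessThan_Suc)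
qed simp

text \<open>Noncommutative chain rule: the Taylor expansion of \<open>F\<close> around \<open>P\<close>, with the increment replaced
  by iterated commutators.\<close>

lemma euler_subst:
  fixes P :: "('a, 'k::comm_ring_1) ncps"
  assumes P: "nth_ncps P [] = 0"
  shows "euler (subst P F) = nsum (\<lambda>l. (commutator P ^^ l) (euler P)
    * subst P (Abs_fps (\<lambda>m. of_nat (Suc (l + m) choose Suc l) * fps_nth F (Suc (l + m)))))"
    (is "_ = nsum (\<lambda>l. ?f l * subst P (?H l))")
proof (rule agree_eqI)
  fix d
  \<comment> \<open>\<open>euler P\<close> has no constant term, and each commutator with
    \<open>P\<close> raises the order by one more.\<close>
  have ordf: "ord_ge (Suc l) (?f l)" for l
    using ord_ge_ad_power[OF P, of 1 "euler P" l] P by (simp add: ord_ge_1)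
  have ordfP: "ord_ge (Suc l + m) (?f l * P ^ m)" for l m
    by (intro ord_ge_mult ordf ord_ge_power P)
  have gr: "graded (\<lambda>l. ?f l * subst P (?H l))"
    unfolding graded_def
  proof
    fix l
    show "ord_ge l (?f l * subst P (?H l))"
      using ord_ge_mult[OF ordf ord_ge_0, of l "subst P (?H l)"] by (rule ord_ge_mono) simp
  qed
  let ?g = "\<lambda>l m. scl (of_nat (Suc (l + m) choose Suc l) * fps_nth F (Suc (l + m))) (?f l * P ^ m)"
  have "agree d (euler (subst P F)) (euler (\<Sum>k\<le>d. scl (fps_nth F k) (P ^ k)))"
    by (intro agree_euler agree_subst P)
  also have "euler (\<Sum>k\<le>d. scl (fps_nth F k) (P ^ k))
      = (\<Sum>k\<le>d. \<Sum>l<k. scl (of_nat (k choose Suc l) * fps_nth F k) (?f l * P ^ (k - Suc l)))"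
    by (simp add: euler_sum euler_power scl_sum mult.commute)
  \<comment> \<open>\<open>m\<close> counts the powers of \<open>P\<close> left on the right, so
    \<open>k = Suc (l + m)\<close>; the pairs outside this triangle have order above
    \<open>d\<close>.\<close>
  also have "\<dots> = (\<Sum>(l, m)\<in>{(l, m). Suc (l + m) \<le> d}. ?g l m)"
    unfolding sum.Sigma[OF finite_atMost ballI[OF finite_lessThan]]
    by (rule sum.reindex_bij_witness[of _ "\<lambda>(l, m). (Suc (l + m), l)" "\<lambda>(k, l). (l, k - Suc l)"])
      (auto simp del: binomial_Suc_Suc)
  also have "agree d \<dots> (\<Sum>(l, m)\<in>{..d} \<times> {..d}. ?g l m)"
    unfolding agree_def nth_ncps_sum
    by (intro allI impI sum.mono_neutral_left)
      (auto simp: ord_geD[OF ordfP] not_le simp del: binomial_Suc_Suc intro: ccontr)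
  also have "(\<Sum>(l, m)\<in>{..d} \<times> {..d}. ?g l m)
      = (\<Sum>l\<le>d. ?f l * (\<Sum>m\<le>d. scl (fps_nth (?H l) m) (P ^ m)))"
    by (simp add: sum.cartesian_product[symmetric] sum_distrib_left)
  also have "agree d \<dots> (\<Sum>l\<le>d. ?f l * subst P (?H l))"
    by (intro agree_sum agree_mult agree_refl agree_sym[OF agree_subst] P)
  also have "agree d \<dots> (nsum (\<lambda>l. ?f l * subst P (?H l)))"
    by (intro agree_sym[OF agree_nsum] gr)
  finally show "agree d (euler (subst P F)) (nsum (\<lambda>l. ?f l * subst P (?H l)))" .
qed

text \<open>The left-hand side is the derivative of order l+1 of ln (1 + X), divided by
  (l+1)!.\<close>

lemma fps_ln_taylor:
  "Abs_fps (\<lambda>m. of_nat (Suc (l + m) choose Suc l) * fps_nth (fps_ln 1) (Suc (l + m)))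
    = fps_const ((- 1) ^ l / of_nat (Suc l)) * inverse ((1 + fps_X :: 'k::field_char_0 fps) ^ Suc l)"
proof -
  have inv: "inverse ((1 + fps_X :: 'k fps) ^ Suc l)
      = Abs_fps (\<lambda>k. of_nat ((l + k) choose k) * (- 1) ^ k)"
    using one_minus_const_fps_X_neg_power'[of "Suc l" "- 1 :: 'k"]
    by (simp add: fps_const_neg[symmetric] del: fps_const_neg)
  have "of_nat (Suc l) * of_nat (Suc (l + m) choose Suc l)
      = (of_nat (Suc (l + m)) * of_nat (l + m choose l) :: 'k)"
    for m
    by (metis Suc_times_binomial_eq mult.commute of_nat_mult)
  then have "of_nat (Suc (l + m) choose Suc l)
      = (of_nat (Suc (l + m)) * of_nat (l + m choose l) / of_nat (Suc l) :: 'k)"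
    for m
    by (subst nonzero_eq_divide_eq) (simp_all add: mult.commute del: of_nat_Suc binomial_Suc_Suc)
  moreover have "l + m choose m = (l + m choose l)" for m
    using binomial_symmetric[of m "l + m"] by simp
  ultimately show ?thesis
    unfolding inv
    by (intro fps_ext) (simp add: fps_ln_nth power_add del: of_nat_Suc binomial_Suc_Suc)
qed

lemma fps_exp_oo_ln: "fps_exp 1 oo fps_ln (1 :: 'k::field_char_0) = 1 + fps_X"
proof -
  have "(fps_exp 1 - 1) oo fps_ln (1 :: 'k) = fps_X"
    unfolding fps_ln_fps_exp_inv[OF one_neq_zero] by (rule fps_inv_right) simp_all
  then show ?thesis
    by (simp add: fps_compose_sub_distrib algebra_simps)
qed


subsection \<open>Dynkin's formula\<close>

fun nested_comm :: "'a::ring list \<Rightarrow> 'a" where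
  "nested_comm [] = 0"
| "nested_comm [x] = x"
| "nested_comm (x # y # zs) = commutator x (nested_comm (y # zs))"

text \<open>A polymorphic copy of \<open>word\<close>: it is used for free letters and for words of
  Booleans, and \<open>map\<close> translates between them.\<close>

definition pair_word :: "'a \<Rightarrow> 'a \<Rightarrow> (nat \<times> nat) list \<Rightarrow> 'a list" where
  "pair_word x y ps = concat (map (\<lambda>(r, s). replicate r x @ replicate s y) ps)"

lemma nested_comm_Cons: "zs \<noteq> [] \<Longrightarrow> nested_comm (x # zs) = commutator x (nested_comm zs)"
  by (cases zs) simp_all

lemma nested_comm_replicate:
  "zs \<noteq> [] \<Longrightarrow> nested_comm (replicate r x @ zs) = (commutator x ^^ r) (nested_comm zs)"
  by (induction r) (simp_all add: nested_comm_Cons)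

lemma ad_power_0: "(commutator x ^^ r) (0 :: 'a::ring) = 0"
  by (induction r) (simp_all add: commutator_def)

lemma ad_power_self: "(commutator x ^^ Suc r) x = (0 :: 'a::ring)"
proof -
  have "(commutator x ^^ Suc r) x = (commutator x ^^ r) (commutator x x)"
    by (simp only: funpow_Suc_right o_apply)
  then show ?thesis by (simp add: commutator_def[of x x] ad_power_0)
qed

text \<open>Innermost is the commutator of \<open>x\<close> with itself. This removes most one-block
  terms of Dynkin's series.\<close>

lemma nested_comm_replicate_self: "nested_comm (replicate (Suc (Suc r)) (x :: 'a::ring)) = 0"
proof -
  have "nested_comm (replicate (Suc (Suc r)) x) = nested_comm (replicate (Suc r) x @ [x])"
    by (simp add: replicate_append_same)
  also have "\<dots> = 0"
    by (simp only: nested_comm_replicate ad_power_self list.distinct nested_comm.simps not_False_eq_True)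
  finally show ?thesis .
qed

lemma scl_2: "scl 2 f = f + f"
  by (simp only: one_add_one[symmetric] scl_add(2) scl_simps)

lemma euler_nested_comm:
  "(\<And>z. z \<in> set zs \<Longrightarrow> euler z = z) \<Longrightarrow> euler (nested_comm zs) = scl (of_nat (length zs)) (nested_comm zs)"
proof (induction zs rule: nested_comm.induct)
  case (3 x y zs)
  then show ?case
    by (simp add: commutator_def euler_mult scl_add scl_2 algebra_simps)
qed simp_all

lemma length_pair_word: "length (pair_word x y ps) = word_length ps"
  by (induction ps) (auto simp: pair_word_def word_length_def)

lemma set_pair_word: "z \<in> set (pair_word x y ps) \<Longrightarrow> z = x \<or> z = y"
proof (induction ps)
  case (Cons p ps)
  obtain r s where "p = (r, s)" by (cases p)
  then have "pair_word x y (p # ps) = replicate r x @ replicate s y @ pair_word x y ps"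
    by (simp add: pair_word_def)
  then have "z \<in> set (replicate r x) \<or> z \<in> set (replicate s y) \<or> z \<in> set (pair_word x y ps)"
    using Cons.prems by simp
  then show ?case
    using Cons.IH by (meson in_set_replicate)
qed (simp add: pair_word_def)

text \<open>The nested commutator is an eigenvector of \<open>euler\<close> with eigenvalue
  \<open>word_length ps\<close>, hence homogeneous in characteristic 0.\<close>

lemma nth_nested_comm_pair_word:
  fixes a b :: 'a and w :: "'a list"
  assumes "length w \<noteq> word_length ps"
  shows "nth_ncps (nested_comm (pair_word (letter a) (letter b) ps) :: ('a, 'k::field_char_0) ncps) w = 0"
proof -
  let ?f = "nested_comm (pair_word (letter a) (letter b) ps) :: ('a, 'k) ncps"
  have "euler ?f = scl (of_nat (word_length ps)) ?f"
    by (subst euler_nested_comm) (auto simp: length_pair_word dest: set_pair_word)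
  from arg_cong[OF this, of "\<lambda>f. nth_ncps f w"]
  show ?thesis using assms by simp
qed

text \<open>The blocks (r, s) of Dynkin's series, cut to a finite set. Blocks with an entry above
  \<open>d\<close> affect only words longer than \<open>d\<close>; the removal of (0, 0) reflects
  the -1 in Ad U - 1.\<close>

definition index_box :: "nat \<Rightarrow> (nat \<times> nat) set" where
  "index_box d = {..d} \<times> {..d} - {(0, 0)}"

lemma finite_index_box [simp]: "finite (index_box d)"
  by (simp add: index_box_def)

lemma word_length_simps: "word_length [] = 0" "word_length ((r, s) # ps) = r + s + word_length ps"
  by (simp_all add: word_length_def)

lemma length_le_word_length:
  assumes "\<forall>(r, s) \<in> set ps. r + s > 0"
  shows "length ps \<le> word_length ps" "(r, s) \<in> set ps \<Longrightarrow> r \<le> word_length ps \<and> s \<le> word_length ps"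
  using assms by (induction ps) (fastforce simp: word_length_simps)+

lemma nth_letter_Nil [simp]: "nth_ncps (letter c) [] = 0"
  by (simp add: nth_letter)

lemma subst_exp_inverse:
  fixes P :: "('c, 'k::field_char_0) ncps"
  assumes "nth_ncps P [] = 0"
  shows "subst P (fps_exp 1) * subst P (fps_exp (- 1))
      = 1" "subst P (fps_exp (- 1)) * subst P (fps_exp 1) = 1"
  using assms by (simp_all add: subst_mult[symmetric] fps_exp_add_mult[symmetric] subst_1)

section \<open>The logarithm of a product of two exponentials of free letters\<close>

context
  fixes a b :: 'a
begin

abbreviation (input) "lx \<equiv> letter a :: ('a, 'k::field_char_0) ncps"
abbreviation (input) "ly \<equiv> letter b :: ('a, 'k::field_char_0) ncps"

definition bch_prod :: "('a, 'k::field_char_0) ncps" where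
  "bch_prod = subst lx (fps_exp 1) * subst ly (fps_exp 1)"

definition bch_prod_inv :: "('a, 'k::field_char_0) ncps" where
  "bch_prod_inv = subst ly (fps_exp (- 1)) * subst lx (fps_exp (- 1))"

definition bch_log :: "('a, 'k::field_char_0) ncps" where
  "bch_log = subst (bch_prod - 1) (fps_ln 1)"

text \<open>Ad U - 1 for U = \<open>bch_prod\<close>.\<close>

definition conj_diff :: "('a, 'k::field_char_0) ncps \<Rightarrow> ('a, 'k) ncps" where
  "conj_diff g = bch_prod * g * bch_prod_inv - g"

text \<open>The logarithmic derivative (D U) U^(-1), that is x + e^(ad x) y.\<close>

definition log_deriv :: "('a, 'k::field_char_0) ncps" where
  "log_deriv = lx + subst lx (fps_exp 1) * ly * subst lx (fps_exp (- 1))"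

text \<open>Dynkin's summand without the sign, the factor 1/(number of blocks) and the factor
  1/(word length). The first two come from the series of ln, the last from undoing D.\<close>

definition dynkin_term :: "(nat \<times> nat) list \<Rightarrow> ('a, 'k::field_char_0) ncps" where
  "dynkin_term ps = scl (1 / (\<Prod>(r, s) \<leftarrow> ps. of_nat (fact r
      * fact s))) (nested_comm (pair_word lx ly ps))"

lemma bch_prod_inverse:
  "bch_prod * bch_prod_inv = (1 :: ('a, 'k::field_char_0) ncps)"
  "bch_prod_inv * bch_prod = (1 :: ('a, 'k) ncps)"
proof -
  note [simp] = subst_exp_inverse[OF nth_letter_Nil]
  have "u * v * (v' * u') = 1" if "u * u' = 1" "v * v' = 1" for u u' v v' :: "('a, 'k) ncps"
    by (metis that mult.assoc mult_1_right)
  then show "bch_prod * bch_prod_inv = (1 :: ('a, 'k) ncps)" "bch_prod_inv * bch_prod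
      = (1 :: ('a, 'k) ncps)"
    unfolding bch_prod_def bch_prod_inv_def by simp_all
qed

lemma nth_bch_prod_Nil: "nth_ncps bch_prod [] = 1"
  by (simp add: bch_prod_def nth_ncps_mult nth_subst_Nil)

lemma exp_bch_log: "subst bch_log (fps_exp 1) = (bch_prod :: ('a, 'k::field_char_0) ncps)"
  unfolding bch_log_def
  by (subst subst_compose)
    (simp_all add: nth_bch_prod_Nil subst_add subst_1 subst_fps_X fps_exp_oo_ln)

lemma nth_bch_log_Nil: "nth_ncps bch_log [] = 0"
  by (simp add: bch_log_def nth_subst_Nil)

text \<open>D e^x = x e^x for a single letter, so D U = x U + e^x y e^y, and inserting e^(-x) e^x
  after y brings U to the right.\<close>

lemma euler_bch_prod: "euler bch_prod = log_deriv * (bch_prod :: ('a, 'k::field_char_0) ncps)"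
proof -
  note inv = subst_exp_inverse[OF nth_letter_Nil]
  have exp: "euler (subst (letter c) (fps_exp 1)) = letter c * subst (letter c) (fps_exp (1 :: 'k))"
    for c :: 'a
    by (simp add: euler_subst_letter subst_mult subst_fps_X)
  have "u' * (u * v) = v" if "u' * u = 1" for u u' v :: "('a, 'k) ncps"
    using that by (simp add: mult.assoc[symmetric])
  then show ?thesis
    unfolding bch_prod_def log_deriv_def by (simp add: euler_mult exp inv distrib_right mult.assoc)
qed

text \<open>U g U^(-1) - g = [U - 1, g] U^(-1), and factors U^(-1) already standing on the right are
  untouched by the commutator, as they commute with U. The extra factor for \<open>l = 0\<close>
  converts D U into \<open>log_deriv\<close>.\<close>

lemma conj_diff_power:
  "(conj_diff ^^ l) log_deriv
    = (commutator (bch_prod - 1) ^^ l) (euler bch_prod) * (bch_prod_inv :: ('a, 'k::field_char_0) ncps) ^ Suc l"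
proof (induction l)
  case 0
  then show ?case by (simp add: euler_bch_prod mult.assoc bch_prod_inverse)
next
  case (Suc l)
  have "conj_diff (h * bch_prod_inv ^ Suc l)
      = commutator (bch_prod - 1) h * (bch_prod_inv :: ('a, 'k) ncps) ^ Suc (Suc l)" for h
  proof -
    have 1: "(bch_prod_inv :: ('a, 'k) ncps) ^ Suc l = bch_prod * bch_prod_inv ^ Suc (Suc l)"
      by (simp add: bch_prod_inverse mult.assoc[symmetric])
    have "conj_diff (h * bch_prod_inv ^ Suc l)
        = bch_prod * h * bch_prod_inv ^ Suc (Suc l) - h * bch_prod_inv ^ Suc l"
      unfolding conj_diff_def by (simp only: power_Suc2 mult.assoc)
    also have "\<dots> = bch_prod * h * bch_prod_inv ^ Suc (Suc l) - h * bch_prod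
        * bch_prod_inv ^ Suc (Suc l)"
      by (simp only: 1 mult.assoc)
    also have "\<dots> = (bch_prod * h - h * bch_prod) * bch_prod_inv ^ Suc (Suc l)"
      by (simp only: left_diff_distrib)
    also have "bch_prod * h - h * bch_prod = commutator (bch_prod - 1) h"
      by (simp add: commutator_def algebra_simps)
    finally show ?thesis .
  qed
  then show ?case by (simp only: funpow.simps o_apply Suc)
qed

text \<open>The chain rule at P = U - 1: the Taylor coefficients of ln contain (1 + P)^(-l-1) =
  U^(-l-1), which is the power absorbed by \<open>conj_diff_power\<close>.\<close>

lemma euler_bch_log:
  "euler bch_log = nsum (\<lambda>l. scl ((- 1) ^ l / of_nat (Suc l)) ((conj_diff ^^ l) (log_deriv :: ('a, 'k::field_char_0) ncps)))"
proof -
  have P: "nth_ncps (bch_prod - 1 :: ('a, 'k) ncps) [] = 0"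
    by (simp add: nth_bch_prod_Nil)
  have inv: "subst (bch_prod - 1) (inverse ((1 + fps_X) ^ n))
      = (bch_prod_inv :: ('a, 'k) ncps) ^ n" for n
  proof -
    let ?s = "subst (bch_prod - 1) :: 'k fps \<Rightarrow> ('a, 'k) ncps"
    have "inverse ((1 + fps_X) ^ n) * (1 + fps_X) ^ n = (1 :: 'k fps)"
      by (rule inverse_mult_eq_1) (simp add: fps_power_zeroth)
    then have "?s (inverse ((1 + fps_X) ^ n)) * ?s ((1 + fps_X) ^ n) = 1"
      by (metis P subst_1 subst_mult)
    then have 1: "?s (inverse ((1 + fps_X) ^ n)) * bch_prod ^ n = 1"
      by (simp add: subst_power[OF P] subst_add subst_1 subst_fps_X[OF P])
    have 2: "(bch_prod :: ('a, 'k) ncps) ^ n * bch_prod_inv ^ n = 1"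
      by (rule left_right_inverse_power) (rule bch_prod_inverse)
    show ?thesis
      using arg_cong[OF 1, of "\<lambda>u. u * bch_prod_inv ^ n"] by (simp add: mult.assoc 2)
  qed
  have [simp]: "euler (bch_prod - 1) = (euler bch_prod :: ('a, 'k) ncps)" by simp
  show ?thesis
    unfolding bch_log_def euler_subst[OF P] fps_ln_taylor subst_mult[OF P] inv subst_fps_const
      conj_diff_power
    by simp
qed

text \<open>Ad U = e^(ad x) e^(ad y), expanded in both exponentials; the term (0, 0) is the identity
  that is subtracted.\<close>

lemma agree_conj_diff:
  "agree d (conj_diff g) (\<Sum>(r, s)\<in>index_box d.
    scl (1 / of_nat (fact r * fact s)) ((commutator lx ^^ r) ((commutator ly ^^ s) (g :: ('a, 'k::field_char_0) ncps))))"
    (is "agree d _ (\<Sum>(r, s)\<in>_. ?t r s)")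
proof -
  have gr: "graded (\<lambda>r. scl (1 / fact r) ((commutator (letter c) ^^ r) h))"
    for c :: 'a and h :: "('a, 'k) ncps"
    using ord_ge_ad_power[of "letter c" 0 h] by (simp add: graded_def ord_ge_arith)
  let ?Y = "\<lambda>g :: ('a, 'k) ncps. subst ly (fps_exp 1) * g * subst ly (fps_exp (- 1))"
  have "bch_prod * g * bch_prod_inv = subst lx (fps_exp 1) * ?Y g * subst lx (fps_exp (- 1))"
    by (simp add: bch_prod_def bch_prod_inv_def mult.assoc)
  also have "\<dots> = nsum (\<lambda>r. scl (1 / fact r) ((commutator lx ^^ r) (?Y g)))"
    by (rule exp_conjugation) simp
  also have "agree d \<dots> (\<Sum>r\<le>d. scl (1 / fact r) ((commutator lx ^^ r) (?Y g)))"
    by (intro agree_nsum gr)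
  also have "agree d \<dots> (\<Sum>r\<le>d. scl (1 / fact r) ((commutator lx ^^ r)
      (\<Sum>s\<le>d. scl (1 / fact s) ((commutator ly ^^ s) g))))"
    unfolding exp_conjugation[OF nth_letter_Nil]
    by (intro agree_sum agree_arith agree_ad_power agree_nsum gr)
  also have "\<dots> = (\<Sum>(r, s)\<in>{..d} \<times> {..d}. ?t r s)"
    by (simp add: ad_power_linear scl_sum sum.cartesian_product)
  also have "\<dots> = g + (\<Sum>(r, s)\<in>index_box d. ?t r s)"
    unfolding index_box_def by (subst sum.remove[of _ "(0, 0)"]) simp_all
  finally have "agree d (bch_prod * g * bch_prod_inv) (g + (\<Sum>(r, s)\<in>index_box d. ?t r s))" .
  from agree_arith(2)[OF this agree_refl[of d g]]
  show ?thesis by (simp add: conj_diff_def)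
qed

text \<open>Among the one-block terms only (1, 0), which gives x, and (r, 1), which give e^(ad x) y,
  are nonzero.\<close>

lemma agree_log_deriv: "agree d log_deriv (\<Sum>p\<in>index_box d. dynkin_term [p] :: ('a, 'k::field_char_0) ncps)"
\<comment> \<open>For \<open>d = 0\<close> the box is empty, and the surviving blocks are not
  contained in it; the claim then concerns only the constant term, which is 0.\<close>
proof (cases "d = 0")
  case True
  then show ?thesis
    by (simp add: agree_def index_box_def log_deriv_def nth_ncps_mult)
next
  case False
  let ?t = "dynkin_term :: _ \<Rightarrow> ('a, 'k) ncps"
  \<comment> \<open>Such a block ends in two equal letters.\<close>
  have t0: "?t [(r, s)] = 0" if "s \<ge> 2 \<or> (s = 0 \<and> r \<ge> 2)" for r s
  proof -
    have "s = Suc (Suc (s - 2)) \<or> s = 0 \<and> r = Suc (Suc (r - 2))"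
      using that by auto
    then consider s' where "s = Suc (Suc s')" | r' where "s = 0" "r = Suc (Suc r')"
      by blast
    then have "nested_comm (pair_word lx ly [(r, s)]) = (0 :: ('a, 'k) ncps)"
    proof cases
      case 1
      then show ?thesis
        using nested_comm_replicate[of "replicate s ly" r "lx :: ('a, 'k) ncps"]
        by (simp add: pair_word_def nested_comm_replicate_self ad_power_0 del: replicate_Suc)
    next
      case 2
      then show ?thesis
        by (simp add: pair_word_def nested_comm_replicate_self del: replicate_Suc)
    qed
    then show ?thesis by (simp add: dynkin_term_def)
  qed
  have t1: "?t [(r, 1)] = scl (1 / fact r) ((commutator lx ^^ r) ly)" for r
    by (simp add: dynkin_term_def pair_word_def nested_comm_replicate)
  have "agree d (log_deriv :: ('a, 'k) ncps) (lx + (\<Sum>r\<le>d. scl (1 / fact r) ((commutator lx ^^ r) ly)))"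
    unfolding log_deriv_def exp_conjugation[OF nth_letter_Nil]
    using ord_ge_ad_power[of "lx :: ('a, 'k) ncps" 0 ly]
    by (intro agree_arith agree_refl agree_nsum) (simp add: graded_def ord_ge_arith)
  also have "\<dots> = (\<Sum>p\<in>insert (1, 0) ((\<lambda>r. (r, 1)) ` {..d}). ?t [p])"
  proof -
    have "?t [(Suc 0, 0)] = lx" by (simp add: dynkin_term_def pair_word_def)
    then show ?thesis
      by (subst sum.insert) (auto simp: sum.reindex inj_on_def t1[unfolded One_nat_def])
  qed
  also have "\<dots> = (\<Sum>p\<in>index_box d. ?t [p])"
  proof (rule sum.mono_neutral_left)
    show "\<forall>p\<in>index_box d - insert (1, 0) ((\<lambda>r. (r, 1)) ` {..d}). ?t [p] = 0"
    proof
      fix p assume p: "p \<in> index_box d - insert (1, 0) ((\<lambda>r. (r, 1)) ` {..d})"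
      obtain r s where "p = (r, s)" by (cases p)
      with p show "?t [p] = 0"
        by (auto simp: index_box_def intro!: t0)
    qed
  qed (use False in \<open>auto simp: index_box_def\<close>)
  finally show ?thesis .
qed

text \<open>Each application of Ad U - 1 puts one more block in front of the word.
  \<open>log_deriv\<close> itself already supplies the last block, hence \<open>Suc k\<close>
  blocks.\<close>

lemma agree_conj_diff_power:
  "agree d ((conj_diff ^^ k) log_deriv)
    (\<Sum>ps | set ps \<subseteq> index_box d \<and> length ps = Suc k. dynkin_term ps :: ('a, 'k::field_char_0) ncps)"
proof (induction k)
  case 0
  have "{ps. set ps \<subseteq> index_box d \<and> length ps = Suc 0} = (\<lambda>p. [p]) ` index_box d"
    by (auto simp: length_Suc_conv)
  then show ?case
    using agree_log_deriv by (simp add: sum.reindex inj_on_def)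
next
  case (Suc k)
  let ?L = "\<lambda>k. {ps. set ps \<subseteq> index_box d \<and> length ps = Suc k}"
  let ?t = "dynkin_term :: _ \<Rightarrow> ('a, 'k) ncps"
  let ?A = "\<lambda>r s g. scl (1 / of_nat (fact r * fact s)) ((commutator lx ^^ r) ((commutator ly ^^ s) (g :: ('a, 'k) ncps)))"
  have "agree d ((conj_diff ^^ Suc k) log_deriv) (\<Sum>(r, s)\<in>index_box d. ?A r s ((conj_diff ^^ k) log_deriv))"
    using agree_conj_diff by simp
  also have "agree d \<dots> (\<Sum>(r, s)\<in>index_box d. ?A r s (\<Sum>ps\<in>?L k. ?t ps))"
    unfolding case_prod_unfold by (intro agree_sum agree_arith agree_ad_power Suc.IH)
  also have "\<dots> = (\<Sum>((r, s), ps)\<in>index_box d \<times> ?L k. ?A r s (?t ps))"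
    by (simp add: case_prod_unfold sum.cartesian_product ad_power_linear scl_sum)
  also have "\<dots> = (\<Sum>(p, ps)\<in>index_box d \<times> ?L k. ?t (p # ps))"
  proof (intro sum.cong refl, clarify)
    fix r s and ps :: "(nat \<times> nat) list"
    assume ps: "set ps \<subseteq> index_box d" "length ps = Suc k"
    \<comment> \<open>Prepending letters acts by commutators only on a nonempty word; this holds
      because no block is (0, 0).\<close>
    then have ne: "pair_word lx ly ps \<noteq> ([] :: ('a, 'k) ncps list)"
      by (cases ps) (auto simp: pair_word_def index_box_def)
    have "nested_comm (pair_word lx ly ((r, s) # ps))
        = nested_comm (replicate r lx @ replicate s ly @ (pair_word lx ly ps :: ('a, 'k) ncps list))"
      by (simp add: pair_word_def)
    also have "\<dots> = (commutator lx ^^ r) ((commutator ly ^^ s) (nested_comm (pair_word lx ly ps)))"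
      using ne by (simp add: nested_comm_replicate)
    finally show "?A r s (?t ps) = ?t ((r, s) # ps)"
      by (simp add: dynkin_term_def ad_power_linear)
  qed
  also have "\<dots> = (\<Sum>ps\<in>?L (Suc k). ?t ps)"
    by (rule sum.reindex_bij_witness[of _ "\<lambda>ps. (hd ps, tl ps)" "\<lambda>(p, ps). p # ps"])
      (auto simp: length_Suc_conv)
  finally show ?case .
qed

text \<open>At \<open>w\<close> only terms with \<open>word_length ps = length w\<close> survive, by
  homogeneity. For these, multiplying by the length both applies D to the logarithm and cancels the
  denominator in \<open>dynkin_coeff\<close>.\<close>

lemma nth_bch_log:
  assumes d: "length w \<le> d"
  shows "nth_ncps bch_log w
    = (\<Sum>ps | ps \<noteq> [] \<and> (\<forall>(r, s) \<in> set ps. r + s > 0) \<and> int (word_length ps) \<le> int d.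
        dynkin_coeff ps * nth_ncps (nested_comm (pair_word lx ly ps)) w)"
    (is "_ = (\<Sum>ps\<in>?I. dynkin_coeff ps * ?c ps)")
proof -
  define n where "n = length w"
  let ?V = "{ps. ps \<noteq> [] \<and> (\<forall>(r, s) \<in> set ps. r + s > 0) \<and> word_length ps = n}"
  let ?L = "\<lambda>k. {ps. set ps \<subseteq> index_box n \<and> length ps = Suc k}"
  have c0: "?c ps = 0" if "word_length ps \<noteq> n" for ps
    using that by (intro nth_nested_comm_pair_word) (simp add: n_def)
  have "(\<Sum>ps\<in>?I. dynkin_coeff ps * ?c ps) = (\<Sum>ps\<in>?V. dynkin_coeff ps * ?c ps)"
    by (rule sum.mono_neutral_right) (use d c0 finite_dynkin_index[of "int d"] in \<open>auto simp: n_def\<close>)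
  also have "\<dots> = nth_ncps bch_log w"
  \<comment> \<open>The empty word is separate because the final step divides by
    \<open>n\<close>.\<close>
  proof (cases "n = 0")
    case True
    have "?V = {}"
      using True length_le_word_length(1) by fastforce
    then show ?thesis
      unfolding \<open>?V = {}\<close> using True by (simp add: n_def nth_bch_log_Nil)
  next
    case False
    have fin: "finite (?L k)" for k
      by (rule finite_subset[OF _ finite_lists_length_eq[of "index_box n" "Suc k"]]) auto
    have "of_nat n * nth_ncps bch_log w
        = nth_ncps (nsum (\<lambda>l. scl ((- 1) ^ l / of_nat (Suc l)) ((conj_diff ^^ l) (log_deriv :: ('a, qfield) ncps)))) w"
      unfolding euler_bch_log[symmetric] by (simp add: n_def)
    also have "\<dots> = (\<Sum>l\<le>n. (- 1) ^ l / of_nat (Suc l) * nth_ncps ((conj_diff ^^ l) log_deriv) w)"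
      by (simp add: nsum_def n_def)
    also have "\<dots> = (\<Sum>l\<le>n. \<Sum>ps\<in>?L l. (- 1) ^ l / of_nat (Suc l) * nth_ncps (dynkin_term ps) w)"
      using agreeD[OF agree_conj_diff_power[where 'k = qfield], of w n] by (simp add: n_def sum_distrib_left)
    also have "\<dots> = (\<Sum>(l, ps)\<in>Sigma {..n} ?L. (- 1) ^ l / of_nat (Suc l) * nth_ncps (dynkin_term ps) w)"
      by (rule sum.Sigma) (use fin in auto)
    also have "\<dots> = (\<Sum>ps\<in>?V. (- 1) ^ (length ps - 1) / of_nat (length ps) * nth_ncps (dynkin_term ps) w)"
    \<comment> \<open>\<open>l\<close> is recovered as \<open>length ps - 1\<close>. The lists in
      the box with another word length are dropped, since their terms vanish at
      \<open>w\<close>.\<close>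
    proof (rule sum.reindex_bij_witness_not_neutral[where S' = "{p \<in> Sigma {..n} ?L. word_length (snd p) \<noteq> n}" and T' = "{}"
          and i = "\<lambda>ps. (length ps - 1, ps)" and j = snd])
      show "finite {p \<in> Sigma {..n} ?L. word_length (snd p) \<noteq> n}"
        using fin by (auto intro!: finite_subset[OF _ finite_SigmaI[of "{..n}" ?L]])
    next
      fix ps assume "ps \<in> ?V - {}"
      then have ps: "ps \<noteq> []" "\<forall>(r, s) \<in> set ps. r + s > 0" "word_length ps = n" by auto
      have "set ps \<subseteq> index_box n"
        using ps length_le_word_length(2)[OF ps(2)] by (fastforce simp: index_box_def)
      then show "(length ps - 1, ps) \<in> Sigma {..n} ?L - {p \<in> Sigma {..n} ?L. word_length (snd p) \<noteq> n}"
        using ps length_le_word_length(1)[OF ps(2)] by (cases ps) auto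
    next
      fix p assume "p \<in> {p \<in> Sigma {..n} ?L. word_length (snd p) \<noteq> n}"
      then show "(case p of (l, ps) \<Rightarrow> (- 1) ^ l / of_nat (Suc l) * nth_ncps (dynkin_term ps) w)
          = (0 :: qfield)"
        by (auto simp: dynkin_term_def c0)
    qed (auto simp: index_box_def)
    also have "\<dots> = (\<Sum>ps\<in>?V. of_nat n * (dynkin_coeff ps * ?c ps))"
      using False by (intro sum.cong refl) (auto simp: dynkin_term_def dynkin_coeff_def field_simps)
    finally have "of_nat n * nth_ncps bch_log w = of_nat n * (\<Sum>ps\<in>?V. dynkin_coeff ps * ?c ps)"
      by (simp add: sum_distrib_left)
    then show ?thesis using False by simp
  qed
  finally show ?thesis by simp
qed

end


section \<open>The twisted power series algebra\<close>

text \<open>Unlike \<open>Nplus\<close> it contains 0, the degree of the unit of the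
  algebra.\<close>

definition cone :: "(int ^ 'r::finite) set" where
  "cone = {n. \<forall>i. 0 \<le> n $ i}"

lemma deg_0 [simp]: "deg 0 = 0"
  by (simp add: deg_def)

lemma deg_nonneg: "n \<in> cone \<Longrightarrow> 0 \<le> deg n"
  by (simp add: cone_def deg_def sum_nonneg)

lemma zero_in_cone [simp]: "0 \<in> cone"
  by (simp add: cone_def)

lemma cone_add: "k \<in> cone \<Longrightarrow> l \<in> cone \<Longrightarrow> k + l \<in> cone"
  by (simp add: cone_def)

lemma cone_deg_0: "n \<in> cone \<Longrightarrow> deg n = 0 \<longleftrightarrow> n = 0"
  by (auto simp: cone_def deg_def sum_nonneg_eq_0_iff vec_eq_iff)

lemma Nplus_iff_cone: "n \<in> Nplus \<longleftrightarrow> n \<in> cone \<and> 0 < deg n"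
  by (simp add: Nplus_def cone_def)

definition splits :: "int ^ 'r::finite \<Rightarrow> ((int ^ 'r) \<times> (int ^ 'r)) set" where
  "splits n = {(k, l). k \<in> cone \<and> l \<in> cone \<and> k + l = n}"

lemma finite_splits [simp]: "finite (splits n)"
proof (rule finite_subset)
  let ?S = "{(k, l). k \<in> Nplus \<and> l \<in> Nplus \<and> k + l = n}"
  show "splits n \<subseteq> ?S \<union> {(0, n), (n, 0)}"
  proof
    fix p assume "p \<in> splits n"
    then obtain k l where p: "p = (k, l)" "k \<in> cone" "l \<in> cone" "k + l = n"
      by (auto simp: splits_def)
    then show "p \<in> ?S \<union> {(0, n), (n, 0)}"
      using deg_nonneg[of k] deg_nonneg[of l] cone_deg_0[of k] cone_deg_0[of l]
      by (cases "k = 0 \<or> l = 0") (auto simp: Nplus_iff_cone)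
  qed
qed (use finite_splittings in simp)

text \<open>The twist is a bicharacter, which makes the product below associative. It is
  instantiated later by q to the power \<open>B k l\<close>.\<close>

locale twist =
  fixes \<tau> :: "int ^ 'r::finite \<Rightarrow> int ^ 'r \<Rightarrow> qfield"
  assumes twist_add_left: "\<tau> (k + l) m = \<tau> k m * \<tau> l m"
    and twist_add_right: "\<tau> k (l + m) = \<tau> k l * \<tau> k m"
    and twist_0 [simp]: "\<tau> 0 m = 1" "\<tau> m 0 = 1"
begin

definition tmul :: "'r coeffs \<Rightarrow> 'r coeffs \<Rightarrow> 'r coeffs" where
  "tmul f g = (\<lambda>n. \<Sum>(k, l)\<in>splits n. f k * g l * \<tau> k l)"

definition tone :: "'r coeffs" where
  "tone n = (if n = 0 then 1 else 0)"

lemma tmul_outside: "n \<notin> cone \<Longrightarrow> tmul f g n = 0"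
  unfolding tmul_def by (rule sum.neutral) (auto simp: splits_def cone_add)

lemma tmul_cong:
  assumes "\<And>k l. k \<in> cone \<Longrightarrow> l \<in> cone \<Longrightarrow> k + l = n \<Longrightarrow> f k * g l = f' k * g' l"
  shows "tmul f g n = tmul f' g' n"
  unfolding tmul_def using assms by (intro sum.cong refl) (auto simp: splits_def)

text \<open>A left factor without term in degree 0 sees only strictly smaller degrees of the right
  factor. All later inductions on the degree rest on this.\<close>

lemma tmul_cong_pos:
  assumes "x \<in> ghat" "\<And>l. l \<in> cone \<Longrightarrow> deg l < deg n \<Longrightarrow> g l = g' l"
  shows "tmul x g n = tmul x g' n"
proof (rule tmul_cong)
  fix k l assume "k \<in> cone" "l \<in> cone" "k + l = n"
  then show "x k * g l = x k * g' l"
    using assms by (cases "k \<in> Nplus") (auto simp: ghat_def Nplus_iff_cone deg_add)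
qed

lemma tmul_0: "x \<in> ghat \<Longrightarrow> tmul x g 0 = 0"
proof -
  assume "x \<in> ghat"
  then have "tmul x g 0 = tmul x (\<lambda>_. 0) 0"
    by (rule tmul_cong_pos) (use deg_nonneg in fastforce)
  then show ?thesis by (simp add: tmul_def)
qed

lemma tmul_linear:
  "tmul (\<lambda>n. f n + g n) h n = tmul f h n + tmul g h n"
  "tmul h (\<lambda>n. f n + g n) n = tmul h f n + tmul h g n"
  "tmul (\<lambda>n. c * f n) h n = c * tmul f h n"
  "tmul h (\<lambda>n. c * f n) n = c * tmul h f n"
  by (simp_all add: tmul_def case_prod_unfold sum.distrib[symmetric] sum_distrib_left algebra_simps)

lemma tmul_zero: "tmul (\<lambda>_. 0) h n = 0" "tmul h (\<lambda>_. 0) n = 0"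
  by (simp_all add: tmul_def)

lemma tmul_sum:
  "tmul (\<lambda>n. \<Sum>i\<in>I. F i n) h n = (\<Sum>i\<in>I. tmul (F i) h n)"
  "tmul h (\<lambda>n. \<Sum>i\<in>I. F i n) n = (\<Sum>i\<in>I. tmul h (F i) n)"
  by (induction I rule: infinite_finite_induct) (simp_all add: tmul_linear tmul_zero)

text \<open>Both sides are sums over triples (i, j, l) with sum \<open>n\<close>, and both twists
  equal the product of the three pairwise ones.\<close>

lemma tmul_assoc: "tmul (tmul f g) h n = tmul f (tmul g h) n"
proof -
  have "tmul (tmul f g) h n
      = (\<Sum>((m, l), (i, j))\<in>Sigma (splits n) (\<lambda>(m, l). splits m). f i * g j * h l * (\<tau> i j * \<tau> m l))"
    unfolding tmul_def
    by (simp add: case_prod_unfold sum_distrib_right sum_distrib_left sum.Sigma mult_ac)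
  also have "\<dots> = (\<Sum>((i, m), (j, l))\<in>Sigma (splits n) (\<lambda>(i, m). splits m). f i * g j * h l
      * (\<tau> i m * \<tau> j l))"
    by (rule sum.reindex_bij_witness[of _ "\<lambda>((i, m), (j, l)). ((i + j, l), (i, j))"
          "\<lambda>((m, l), (i, j)). ((i, j + l), (j, l))"])
      (auto simp: splits_def cone_add add.assoc twist_add_left twist_add_right)
  also have "\<dots> = tmul f (tmul g h) n"
    unfolding tmul_def
    by (simp add: case_prod_unfold sum_distrib_right sum_distrib_left sum.Sigma mult_ac)
  finally show ?thesis .
qed

lemma tmul_tone_left: "n \<in> cone \<Longrightarrow> tmul tone f n = f n"
proof -
  assume n: "n \<in> cone"
  have "tmul tone f n = (\<Sum>p\<in>splits n. if p = (0, n) then f n else 0)"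
    unfolding tmul_def by (rule sum.cong) (auto simp: tone_def splits_def split: if_splits)
  moreover have "(0, n) \<in> splits n" using n by (simp add: splits_def)
  ultimately show ?thesis by simp
qed

lemma tmul_tone_right: "n \<in> cone \<Longrightarrow> tmul f tone n = f n"
proof -
  assume n: "n \<in> cone"
  have "tmul f tone n = (\<Sum>p\<in>splits n. if p = (n, 0) then f n else 0)"
    unfolding tmul_def by (rule sum.cong) (auto simp: tone_def splits_def split: if_splits)
  moreover have "(n, 0) \<in> splits n" using n by (simp add: splits_def)
  ultimately show ?thesis by simp
qed

primrec tpow :: "'r coeffs \<Rightarrow> nat \<Rightarrow> 'r coeffs" where
  "tpow f 0 = tone"
| "tpow f (Suc k) = tmul f (tpow f k)"

text \<open>For \<open>f\<close> supported on \<open>Nplus\<close> the power \<open>tpow f k\<close>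
  vanishes in degrees below \<open>k\<close>, so the cutoff gives the full series.\<close>

definition tsub :: "'r coeffs \<Rightarrow> qfield fps \<Rightarrow> 'r coeffs" where
  "tsub f F = (\<lambda>n. \<Sum>k\<le>nat (deg n). fps_nth F k * tpow f k n)"


subsection \<open>Evaluation of noncommutative power series\<close>

text \<open>Substitutes \<open>z c\<close> for the letter \<open>c\<close> in all words of length at
  most \<open>d\<close>, peeling off first letters.\<close>

primrec eval_upto :: "('a::finite \<Rightarrow> 'r coeffs) \<Rightarrow> nat \<Rightarrow> ('a, qfield) ncps \<Rightarrow> 'r coeffs" where
  "eval_upto z 0 f = (\<lambda>n. nth_ncps f [] * tone n)"
| "eval_upto z (Suc d) f = (\<lambda>n. nth_ncps f [] * tone n
    + (\<Sum>c\<in>UNIV. tmul (z c) (eval_upto z d (ncps_shift c f)) n))"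

definition eval_ncps :: "('a::finite \<Rightarrow> 'r coeffs) \<Rightarrow> ('a, qfield) ncps \<Rightarrow> 'r coeffs" where
  "eval_ncps z f = (\<lambda>n. eval_upto z (nat (deg n)) f n)"

lemma eval_upto_linear:
  "eval_upto z d (f + g) n = eval_upto z d f n + eval_upto z d g n"
  "eval_upto z d (scl k f) n = k * eval_upto z d f n"
proof -
  have "eval_upto z d (f + g) = (\<lambda>n. eval_upto z d f n + eval_upto z d g n)"
    by (induction d arbitrary: f g)
      (simp_all add: ncps_shift_linear tmul_linear sum.distrib algebra_simps)
  then show "eval_upto z d (f + g) n = eval_upto z d f n + eval_upto z d g n" by simp
  have "eval_upto z d (scl k f) = (\<lambda>n. k * eval_upto z d f n)"
    by (induction d arbitrary: f)
      (simp_all add: ncps_shift_linear tmul_linear sum_distrib_left algebra_simps)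
  then show "eval_upto z d (scl k f) n = k * eval_upto z d f n" by simp
qed

lemma eval_upto_0: "eval_upto z d 0 n = 0"
  using eval_upto_linear(2)[of z d 0 0 n] by simp

lemma eval_upto_sum: "eval_upto z d (sum F I) n = (\<Sum>i\<in>I. eval_upto z d (F i) n)"
  by (induction I rule: infinite_finite_induct) (simp_all add: eval_upto_linear eval_upto_0)

lemma eval_upto_agree: "agree d f g \<Longrightarrow> eval_upto z d f = eval_upto z d g"
proof (induction d arbitrary: f g)
  case (Suc d)
  have "eval_upto z d (ncps_shift c f) = eval_upto z d (ncps_shift c g)" for c
    using Suc.prems by (intro Suc.IH) (simp add: agree_def)
  then show ?case using Suc.prems by (simp add: agree_def)
qed (simp add: agree_def)

lemma eval_upto_outside: "n \<notin> cone \<Longrightarrow> eval_upto z d f n = 0"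
  by (cases d) (auto simp: tone_def tmul_outside)

context
  fixes z :: "'a::finite \<Rightarrow> 'r coeffs"
  assumes z: "z c \<in> ghat"
begin

text \<open>Every letter raises the degree by at least one, so words longer than
  \<open>deg n\<close> do not reach degree \<open>n\<close>.\<close>

lemma eval_upto_stable:
  "n \<in> cone \<Longrightarrow> deg n \<le> int d \<Longrightarrow> deg n \<le> int d' \<Longrightarrow> eval_upto z d f n = eval_upto z d' f n"
proof (induction d arbitrary: d' f n)
  case 0
  then have "n = 0" using cone_deg_0[of n] deg_nonneg[of n] by simp
  then show ?case by (cases d') (simp_all add: tmul_0 z)
next
  case (Suc d)
  show ?case
  proof (cases d')
    case 0
    then have "n = 0" using Suc.prems cone_deg_0[of n] deg_nonneg[of n] by simp
    then show ?thesis using 0 by (simp add: tmul_0 z)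
  next
    case (Suc e)
    have "tmul (z c) (eval_upto z d (ncps_shift c f)) n
        = tmul (z c) (eval_upto z e (ncps_shift c f)) n" for c
      by (intro tmul_cong_pos z Suc.IH) (use Suc.prems Suc in auto)
    then show ?thesis using Suc by simp
  qed
qed

lemma eval_ncps_upto: "deg n \<le> int d \<Longrightarrow> eval_ncps z f n = eval_upto z d f n"
proof (cases "n \<in> cone")
  case True
  then show "deg n \<le> int d \<Longrightarrow> eval_ncps z f n = eval_upto z d f n"
    unfolding eval_ncps_def using deg_nonneg by (intro eval_upto_stable) auto
qed (simp add: eval_ncps_def eval_upto_outside)

lemma eval_ncps_rec:
  "eval_ncps z f n = nth_ncps f [] * tone n + (\<Sum>c\<in>UNIV. tmul (z c) (eval_ncps z (ncps_shift c f)) n)"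
proof -
  let ?d = "nat (deg n)"
  have "eval_ncps z f n = eval_upto z (Suc ?d) f n"
    by (intro eval_ncps_upto) simp
  moreover have "tmul (z c) (eval_upto z ?d (ncps_shift c f)) n
      = tmul (z c) (eval_ncps z (ncps_shift c f)) n" for c
    by (intro tmul_cong_pos z eval_ncps_upto[symmetric]) auto
  ultimately show ?thesis by simp
qed

lemma eval_ncps_linear:
  "eval_ncps z (f + g) n = eval_ncps z f n + eval_ncps z g n"
  "eval_ncps z (f - g) n = eval_ncps z f n - eval_ncps z g n"
  "eval_ncps z (scl k f) n = k * eval_ncps z f n"
proof -
  show "eval_ncps z (f + g) n = eval_ncps z f n + eval_ncps z g n" for f g
    by (simp add: eval_ncps_def eval_upto_linear)
  from this[of "f - g" g] show "eval_ncps z (f - g) n = eval_ncps z f n - eval_ncps z g n"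
    by simp
qed (simp add: eval_ncps_def eval_upto_linear)

lemma eval_ncps_outside: "n \<notin> cone \<Longrightarrow> eval_ncps z f n = 0"
  by (simp add: eval_ncps_def eval_upto_outside)

text \<open>Induction on the degree: peeling one letter off \<open>f * g\<close> leaves a product to
  be evaluated only in smaller degree, because \<open>z c\<close> stands in front of it.\<close>

lemma eval_ncps_mult: "eval_ncps z (f * g) = tmul (eval_ncps z f) (eval_ncps z g)"
proof
  fix n
  show "eval_ncps z (f * g) n = tmul (eval_ncps z f) (eval_ncps z g) n"
  proof (induction "nat (deg n)" arbitrary: n f rule: less_induct)
    case less
    show ?case
    proof (cases "n \<in> cone")
      case False
      then show ?thesis by (simp add: eval_ncps_outside tmul_outside)
    next
      case True
      let ?a = "nth_ncps f []"
      let ?e = "eval_ncps z"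
      have *: "tmul (z c) (?e (ncps_shift c (f * g))) n
          = ?a * tmul (z c) (?e (ncps_shift c g)) n + tmul (tmul (z c) (?e (ncps_shift c f))) (?e g) n" for c
      proof -
        have "tmul (z c) (?e (ncps_shift c (f * g))) n
            = tmul (z c) (\<lambda>l. ?a * ?e (ncps_shift c g) l + tmul (?e (ncps_shift c f)) (?e g) l) n"
        proof (intro tmul_cong_pos z)
          fix l :: "int ^ 'r" assume "l \<in> cone" "deg l < deg n"
          then have "?e (ncps_shift c f * g) l = tmul (?e (ncps_shift c f)) (?e g) l"
            using deg_nonneg[of l] by (intro less) auto
          then show "?e (ncps_shift c (f * g)) l
              = ?a * ?e (ncps_shift c g) l + tmul (?e (ncps_shift c f)) (?e g) l"
            by (simp add: ncps_shift_mult eval_ncps_linear)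
        qed
        then show ?thesis by (simp add: tmul_linear tmul_assoc)
      qed
      have "?e (f * g) n = ?a * (nth_ncps g [] * tone n + (\<Sum>c\<in>UNIV. tmul (z c) (?e (ncps_shift c g)) n))
          + (\<Sum>c\<in>UNIV. tmul (tmul (z c) (?e (ncps_shift c f))) (?e g) n)"
        by (subst eval_ncps_rec) (simp add: * nth_ncps_mult sum.distrib sum_distrib_left algebra_simps)
      also have "\<dots> = ?a * ?e g n + (\<Sum>c\<in>UNIV. tmul (tmul (z c) (?e (ncps_shift c f))) (?e g) n)"
        by (simp only: eval_ncps_rec[of g n])
      also have "\<dots> = tmul (\<lambda>n. ?a * tone n + (\<Sum>c\<in>UNIV. tmul (z c) (?e (ncps_shift c f)) n)) (?e g) n"
        using True by (simp add: tmul_linear tmul_sum tmul_tone_left)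
      also have "\<dots> = tmul (?e f) (?e g) n"
        by (simp only: eval_ncps_rec[of f, symmetric])
      finally show ?thesis .
    qed
  qed
qed

lemma eval_ncps_1: "eval_ncps z 1 = tone"
proof
  fix n
  have "eval_ncps z 0 = (\<lambda>_. 0)"
    using eval_ncps_linear(3)[of 0 0] by (simp add: fun_eq_iff)
  then show "eval_ncps z 1 n = tone n"
    by (subst eval_ncps_rec) (simp add: ncps_shift_linear tmul_zero)
qed

lemma eval_ncps_letter: "eval_ncps z (letter c) = z c"
proof
  fix n
  have "ncps_shift c' (letter c) = (if c' = c then 1 else 0 :: ('a, qfield) ncps)" for c'
    by (rule ncps_eqI) (auto simp: nth_letter)
  moreover have "eval_ncps z 0 = (\<lambda>_. 0)"
    using eval_ncps_linear(3)[of 0 0] by (simp add: fun_eq_iff)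
  ultimately have "tmul (z c') (eval_ncps z (ncps_shift c' (letter c))) n = (if c'
      = c then tmul (z c) tone n else 0)" for c'
    by (simp add: eval_ncps_1 tmul_zero)
  then have "eval_ncps z (letter c) n = (\<Sum>c'\<in>UNIV. if c' = c then tmul (z c) tone n else 0)"
    by (subst eval_ncps_rec) (simp add: nth_letter)
  then show "eval_ncps z (letter c) n = z c n"
    using z[of c] by (cases "n \<in> cone") (simp_all add: tmul_tone_right tmul_outside ghat_def Nplus_iff_cone)
qed

lemma eval_ncps_power: "eval_ncps z (f ^ k) = tpow (eval_ncps z f) k"
  by (induction k) (simp_all add: eval_ncps_1 eval_ncps_mult)

lemma eval_ncps_subst:
  assumes "nth_ncps f [] = 0"
  shows "eval_ncps z (subst f F) = tsub (eval_ncps z f) F"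
proof
  fix n :: "int ^ 'r"
  let ?d = "nat (deg n)"
  have "eval_ncps z (subst f F) n = eval_upto z ?d (\<Sum>k\<le>?d. scl (fps_nth F k) (f ^ k)) n"
    by (simp only: eval_ncps_def eval_upto_agree[OF agree_subst[OF assms]])
  also have "\<dots> = (\<Sum>k\<le>?d. fps_nth F k * eval_ncps z (f ^ k) n)"
    by (simp only: eval_upto_sum eval_upto_linear eval_ncps_def)
  finally show "eval_ncps z (subst f F) n = tsub (eval_ncps z f) F n"
    by (simp only: tsub_def eval_ncps_power)
qed

end

text \<open>Transferred from the free algebra on one letter (alphabet \<open>unit\<close>), with
  \<open>x\<close> substituted for that letter.\<close>

lemma tsub_compose:
  assumes x: "x \<in> ghat" and F: "fps_nth F 0 = 0"
  shows "tsub (tsub x F) H = tsub x (H oo F)"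
proof -
  let ?z = "\<lambda>_ :: unit. x"
  have z: "?z c \<in> ghat" for c using x .
  have sub: "tsub x F = eval_ncps ?z (subst (letter ()) F)" for F
    by (simp add: eval_ncps_subst[of "\<lambda>_ :: unit. x", OF z] eval_ncps_letter[of "\<lambda>_ :: unit. x", OF z] nth_letter)
  have "tsub (tsub x F) H = eval_ncps ?z (subst (subst (letter ()) F) H)"
    unfolding sub[of F] by (rule eval_ncps_subst[of "\<lambda>_ :: unit. x", OF z, symmetric]) (simp add: nth_subst_Nil F)
  also have "\<dots> = tsub x (H oo F)"
    unfolding sub by (simp add: subst_compose nth_letter F)
  finally show ?thesis .
qed

lemma tsub_fps_X:
  assumes "x \<in> ghat"
  shows "tsub x fps_X = x"
proof -
  have z: "(\<lambda>_ :: unit. x) c \<in> ghat" for c using assms .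
  have "tsub x fps_X = eval_ncps (\<lambda>_ :: unit. x) (subst (letter ()) fps_X)"
    by (simp add: eval_ncps_subst[of "\<lambda>_ :: unit. x", OF z] eval_ncps_letter[of "\<lambda>_ :: unit. x", OF z] nth_letter)
  also have "subst (letter ()) fps_X = (letter () :: (unit, qfield) ncps)"
    by (rule subst_fps_X) (simp add: nth_letter)
  also have "eval_ncps (\<lambda>_ :: unit. x) (letter ()) = x"
    by (rule eval_ncps_letter[of "\<lambda>_ :: unit. x", OF z])
  finally show ?thesis .
qed

text \<open>\<open>fps_ln 1\<close> is the series of ln (1 + X), so applied to exp - 1 it gives back
  the exponent.\<close>

lemma exp_injective:
  assumes "x \<in> ghat" "y \<in> ghat" and eq: "tsub x (fps_exp 1) = tsub y (fps_exp 1)"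
  shows "x = y"
proof -
  have "fps_ln 1 oo (fps_exp 1 - 1) = (fps_X :: qfield fps)"
    unfolding fps_ln_fps_exp_inv[OF one_neq_zero] by (rule fps_inv) simp_all
  then have ln: "tsub (tsub u (fps_exp 1 - 1)) (fps_ln 1) = u" if "u \<in> ghat" for u
    using that by (simp add: tsub_compose tsub_fps_X)
  have diff: "tsub u (fps_exp 1 - 1) = (\<lambda>n. tsub u (fps_exp 1) n - tsub u 1 n)" for u
    by (simp add: tsub_def fun_eq_iff left_diff_distrib sum_subtractf)
  have one: "tsub u 1 = tone" for u
    by (auto simp: tsub_def fun_eq_iff if_distrib[of "\<lambda>u. u * _"] cong: if_cong)
  have "x = tsub (tsub x (fps_exp 1 - 1)) (fps_ln 1)"
    by (rule ln[OF assms(1), symmetric])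
  also have "tsub x (fps_exp 1 - 1) = tsub y (fps_exp 1 - 1)"
    unfolding diff one eq ..
  also have "tsub (tsub y (fps_exp 1 - 1)) (fps_ln 1) = y"
    by (rule ln[OF assms(2)])
  finally show ?thesis .
qed

end


section \<open>The quantum exponential\<close>

text \<open>The equation determines each coefficient from the earlier ones. It yields e^(f+g) = e^f
  e^g by comparing logarithmic derivatives.\<close>

lemma fps_linear_ode_unique:
  fixes F :: "'k::field_char_0 fps"
  assumes "fps_deriv F = F * M" "fps_deriv H = H * M" "fps_nth F 0 = fps_nth H 0"
  shows "F = H"
proof (rule fps_ext)
  fix n
  show "fps_nth F n = fps_nth H n"
  proof (induction n rule: less_induct)
    case (less n)
    show ?case
    proof (cases n)
      case (Suc m)
      have "fps_nth (F * M) m = fps_nth (H * M) m"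
        unfolding fps_mult_nth by (intro sum.cong refl) (use Suc less in auto)
      then have "of_nat (Suc m) * fps_nth F (Suc m) = of_nat (Suc m) * fps_nth H (Suc m)"
        by (metis assms(1,2) fps_deriv_nth Suc_eq_plus1)
      then show ?thesis using Suc by (simp del: of_nat_Suc)
    qed (use assms in simp)
  qed
qed

lemma fps_exp_compose_add:
  fixes f g :: "'k::field_char_0 fps"
  assumes "fps_nth f 0 = 0" "fps_nth g 0 = 0"
  shows "fps_exp 1 oo (f + g) = (fps_exp 1 oo f) * (fps_exp 1 oo g)"
proof (rule fps_linear_ode_unique)
  have d: "fps_deriv (fps_exp 1 oo h) = (fps_exp 1 oo h) * fps_deriv h" if "fps_nth h 0
      = 0" for h :: "'k fps"
    using fps_compose_deriv[OF that, of "fps_exp 1"] by simp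
  show "fps_deriv (fps_exp 1 oo (f + g)) = (fps_exp 1 oo (f + g)) * (fps_deriv f + fps_deriv g)"
    using d[of "f + g"] assms by simp
  show "fps_deriv ((fps_exp 1 oo f) * (fps_exp 1 oo g))
      = (fps_exp 1 oo f) * (fps_exp 1 oo g) * (fps_deriv f + fps_deriv g)"
    by (simp add: d assms algebra_simps)
qed simp

text \<open>The exponent of \<open>Psi\<close> with p = q^a. Dividing by q - 1/q, as the embedding
  does, cancels the denominator of the q-number and leaves p^j - p^(-j).\<close>

definition fps_dilog :: "'k::field_char_0 \<Rightarrow> 'k fps" where
  "fps_dilog p = Abs_fps (\<lambda>j. if j = 0 then 0 else (- 1) ^ (j
      + 1) / (of_nat j * (p ^ j - inverse p ^ j)))"

definition fps_qexp :: "'k::field_char_0 \<Rightarrow> 'k fps" where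
  "fps_qexp p = fps_exp 1 oo fps_dilog p"

text \<open>The q-Pochhammer symbol (Q; Q)_n.\<close>

definition qpoch :: "'k::field \<Rightarrow> nat \<Rightarrow> 'k" where
  "qpoch Q n = (\<Prod>i<n. 1 - Q ^ Suc i)"

lemma qpoch_simps [simp]: "qpoch Q 0 = 1" "qpoch Q (Suc n) = qpoch Q n * (1 - Q ^ Suc n)"
  by (simp_all add: qpoch_def)

text \<open>\<open>roots\<close> says that p^2 is not a root of unity; this keeps the denominators
  (p^2; p^2)_n nonzero.\<close>

lemma one_minus_square_power_nonzero:
  fixes p :: "'k::field"
  assumes p: "p \<noteq> 0" and roots: "\<And>j. j > 0 \<Longrightarrow> p ^ j \<noteq> inverse p ^ j"
  shows "1 - (p\<^sup>2) ^ Suc n \<noteq> 0"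
proof
  assume "1 - (p\<^sup>2) ^ Suc n = 0"
  then have "p ^ Suc n * p ^ Suc n = 1"
    by (simp add: power2_eq_square power_mult_distrib mult_ac)
  then have "p ^ Suc n = inverse p ^ Suc n"
    using p by (metis inverse_unique power_inverse)
  then show False using roots[of "Suc n"] by blast
qed

text \<open>The series is determined by \<open>E(pu) = (1 + u) E(u/p)\<close>, which holds because
  \<open>L(pu) - L(u/p) = ln (1 + u)\<close> for the exponent \<open>L\<close> of \<open>E\<close>.\<close>

lemma fps_qexp_nth:
  fixes p :: "'k::field_char_0"
  assumes p: "p \<noteq> 0" and roots: "\<And>j. j > 0 \<Longrightarrow> p ^ j \<noteq> inverse p ^ j"
  shows "fps_nth (fps_qexp p) n = (- p) ^ n / qpoch (p\<^sup>2) n"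
proof -
  let ?S = "\<lambda>c F. F oo (fps_const c * fps_X)"
  let ?L = "fps_dilog p" and ?E = "fps_qexp p"
  have L0 [simp]: "fps_nth ?L 0 = 0" by (simp add: fps_dilog_def)
  have S: "fps_nth (?S c F) k = c ^ k * fps_nth F k" for c :: 'k and F k
    by (simp add: fps_compose_linear)
  have SE: "?S c ?E = fps_exp 1 oo ?S c ?L" for c
    unfolding fps_qexp_def by (rule fps_compose_assoc[symmetric]) simp_all
  have "?S p ?L = ?S (inverse p) ?L + fps_ln 1"
  proof (rule fps_ext)
    fix j
    show "fps_nth (?S p ?L) j = fps_nth (?S (inverse p) ?L + fps_ln 1) j"
    proof (cases "j = 0")
      case False
      have "(- 1 :: 'k) ^ (j + 1) = (- 1) ^ (j - 1)"
        using False by (cases j) simp_all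
      then have "(p ^ j - inverse p ^ j) * fps_nth ?L j = fps_nth (fps_ln 1) j"
        using roots[of j] False by (simp add: fps_dilog_def fps_ln_nth del: power_inverse)
      then show ?thesis
        unfolding fps_add_nth S by (simp add: left_diff_distrib diff_eq_eq add.commute)
    qed (simp add: S)
  qed
  then have func: "?S p ?E = (?S (inverse p) ?E) * (1 + fps_X)"
    unfolding SE by (simp add: fps_exp_compose_add fps_exp_oo_ln)
  show ?thesis
  proof (induction n)
    case 0
    then show ?case by (simp add: fps_qexp_def)
  next
    case (Suc n)
    have "fps_nth (?S p ?E) (Suc n) = fps_nth (?S (inverse p) ?E * (1 + fps_X)) (Suc n)"
      by (simp only: func)
    then have "p ^ Suc n * fps_nth ?E (Suc n) = inverse p ^ Suc n * fps_nth ?E (Suc n)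
        + inverse p ^ n * fps_nth ?E n"
      by (simp add: S distrib_left del: power_Suc power_inverse)
    then have "p ^ Suc n * (p ^ Suc n * fps_nth ?E (Suc n))
        = (p ^ Suc n * inverse p ^ Suc n) * fps_nth ?E (Suc n) + p * (p ^ n * inverse p ^ n) * fps_nth ?E n"
      by (simp add: distrib_left mult.assoc)
    moreover have "p ^ k * inverse p ^ k = 1" for k
      using p by (simp flip: power_mult_distrib)
    moreover have "(p\<^sup>2) ^ Suc n = p ^ Suc n * p ^ Suc n"
      by (simp add: power2_eq_square power_mult_distrib mult_ac)
    ultimately have "(p\<^sup>2) ^ Suc n * fps_nth ?E (Suc n) = fps_nth ?E (Suc n) + p * fps_nth ?E n"
      by (simp only: mult.assoc mult_1_left mult_1_right)
    then have e: "(1 - (p\<^sup>2) ^ Suc n) * fps_nth ?E (Suc n) = (- p) * fps_nth ?E n"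
      by (simp add: algebra_simps)
    have nz: "1 - (p\<^sup>2) ^ Suc n \<noteq> 0"
      using p roots by (rule one_minus_square_power_nonzero)
    from e nz have "fps_nth ?E (Suc n) = (- p) * fps_nth ?E n / (1 - (p\<^sup>2) ^ Suc n)"
      by (simp add: field_simps)
    then show ?case by (simp add: Suc)
  qed
qed

text \<open>Let T(a, b) be the left-hand side. Splitting 1 - Q^(a+1) = (1 - Q^(a+1-k)) + Q^(a+1-k)
  (1 - Q^k) in each summand gives (1 - Q^(a+1)) T(a+1, b) = T(a, b) - Q^a T(a, b-1), without the
  last term if b = 0. The right-hand side satisfies the same recursion.\<close>

lemma pentagon_qpoch:
  fixes Q :: "'k::field"
  assumes nz: "\<And>n. qpoch Q n \<noteq> 0"
  shows "(\<Sum>k | k \<le> a \<and> k \<le> b. (- 1) ^ k * Q ^ (k choose 2) / (qpoch Q (a - k) * qpoch Q k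
      * qpoch Q (b - k)))
    = Q ^ (a * b) / (qpoch Q a * qpoch Q b)"
proof (induction a arbitrary: b)
  case 0
  have "{k. k \<le> 0 \<and> k \<le> b} = {0}" by auto
  then show ?case by (simp add: binomial_eq_0)
next
  case (Suc a)
  let ?t = "\<lambda>a b k. (- 1) ^ k * Q ^ (k choose 2) / (qpoch Q (a - k) * qpoch Q k * qpoch Q (b - k))"
  let ?T = "\<lambda>a b. \<Sum>k | k \<le> a \<and> k \<le> b. ?t a b k"
  have nz1: "1 - Q ^ Suc n \<noteq> 0" for n
    using nz[of "Suc n"] by auto
  have fin: "finite {k. k \<le> a \<and> k \<le> b}" for a b :: nat
    by (rule finite_subset[of _ "{..a}"]) auto
  \<comment> \<open>The factor lowers the first Pochhammer index by one and kills the summand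
    \<open>k = Suc a\<close>.\<close>
  have A: "(\<Sum>k | k \<le> Suc a \<and> k \<le> b. (1 - Q ^ (Suc a - k)) * ?t (Suc a) b k) = ?T a b"
  proof (rule sum.mono_neutral_cong_right)
    fix k assume "k \<in> {k. k \<le> a \<and> k \<le> b}"
    then have "k \<le> a" by simp
    then show "(1 - Q ^ (Suc a - k)) * ?t (Suc a) b k = ?t a b k"
      using nz1[of "a - k"] by (simp add: Suc_diff_le del: power_Suc)
  qed (auto simp: fin le_Suc_eq)
  \<comment> \<open>The factor kills \<open>k = 0\<close>. Shifting \<open>k\<close> by one then
    lowers \<open>a\<close> and \<open>b\<close> together and produces the sign and Q^a.\<close>
  have C: "(\<Sum>k | k \<le> Suc a \<and> k \<le> b. Q ^ (Suc a - k) * (1 - Q ^ k) * ?t (Suc a) b k)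
      = (if b = 0 then 0 else - (Q ^ a) * ?T a (b - 1))"
  proof (cases b)
    case 0
    have "{k. k \<le> Suc a \<and> k \<le> 0} = {0}" by auto
    then show ?thesis using 0 by simp
  next
    case (Suc b')
    have "(\<Sum>k | k \<le> Suc a \<and> k \<le> b. Q ^ (Suc a - k) * (1 - Q ^ k) * ?t (Suc a) b k)
        = (\<Sum>k\<in>Suc ` {k. k \<le> a \<and> k \<le> b'}. Q ^ (Suc a - k) * (1 - Q ^ k) * ?t (Suc a) b k)"
    proof (rule sum.mono_neutral_right)
      show "\<forall>k\<in>{k. k \<le> Suc a \<and> k \<le> b} - Suc ` {k. k \<le> a \<and> k \<le> b'}. Q ^ (Suc a - k) * (1 - Q ^ k)
          * ?t (Suc a) b k = 0"
      proof
        fix k assume "k \<in> {k. k \<le> Suc a \<and> k \<le> b} - Suc ` {k. k \<le> a \<and> k \<le> b'}"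
        then have "k = 0" using Suc by (cases k) auto
        then show "Q ^ (Suc a - k) * (1 - Q ^ k) * ?t (Suc a) b k = 0" by simp
      qed
    qed (use Suc fin in auto)
    also have "\<dots> = (\<Sum>k | k \<le> a \<and> k \<le> b'. - (Q ^ a) * ?t a b' k)"
    proof (subst sum.reindex, simp, rule sum.cong[OF refl], unfold o_apply)
      fix k assume "k \<in> {k. k \<le> a \<and> k \<le> b'}"
      then have k: "k \<le> a" by simp
      have ch: "Suc k choose 2 = k + (k choose 2)" by (simp add: numeral_2_eq_2)
      have 1: "Q ^ (Suc a - Suc k) * Q ^ (Suc k choose 2) = Q ^ a * Q ^ (k choose 2)"
        using k by (simp add: ch flip: power_add)
      have 2: "(1 - Q ^ Suc k) / qpoch Q (Suc k) = 1 / qpoch Q k"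
        using nz1[of k] by simp
      have 3: "Q ^ (Suc a - Suc k) * (1 - Q ^ Suc k) * ?t (Suc a) b (Suc k)
          = - ((- 1) ^ k * (Q ^ (Suc a - Suc k) * Q ^ (Suc k choose 2)) * ((1 - Q ^ Suc k) / qpoch Q (Suc k)) / (qpoch Q (a - k) * qpoch Q (b' - k)))"
        using Suc by (simp del: qpoch_simps add: field_simps)
      show "Q ^ (Suc a - Suc k) * (1 - Q ^ Suc k) * ?t (Suc a) b (Suc k) = - (Q ^ a) * ?t a b' k"
        unfolding 3 1 2 by (simp add: mult_ac)
    qed
    finally show ?thesis using Suc by (simp add: sum_distrib_left)
  qed
  have "(1 - Q ^ Suc a) * ?T (Suc a) b = (\<Sum>k | k \<le> Suc a \<and> k \<le> b. (1 - Q ^ (Suc a - k))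
      * ?t (Suc a) b k)
      + (\<Sum>k | k \<le> Suc a \<and> k \<le> b. Q ^ (Suc a - k) * (1 - Q ^ k) * ?t (Suc a) b k)"
    unfolding sum_distrib_left sum.distrib[symmetric]
  proof (rule sum.cong[OF refl])
    fix k assume "k \<in> {k. k \<le> Suc a \<and> k \<le> b}"
    then have "Q ^ Suc a = Q ^ (Suc a - k) * Q ^ k" by (simp flip: power_add)
    then have "1 - Q ^ Suc a = (1 - Q ^ (Suc a - k)) + Q ^ (Suc a - k) * (1 - Q ^ k)"
      by (simp add: algebra_simps)
    then show "(1 - Q ^ Suc a) * ?t (Suc a) b k
        = (1 - Q ^ (Suc a - k)) * ?t (Suc a) b k + Q ^ (Suc a - k) * (1 - Q ^ k) * ?t (Suc a) b k"
      by (simp only: distrib_right)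
  qed
  also have "\<dots> = ?T a b + (if b = 0 then 0 else - (Q ^ a) * ?T a (b - 1))"
    by (simp only: A C)
  also have "\<dots> = Q ^ (Suc a * b) / (qpoch Q a * qpoch Q b)"
  proof (cases b)
    case 0
    then show ?thesis using Suc.IH[of 0] by simp
  next
    case b: (Suc b')
    have "?T a b + - (Q ^ a) * ?T a b' = Q ^ (a * b) / (qpoch Q a * qpoch Q b) - Q ^ a * (Q ^ (a
        * b') / (qpoch Q a * qpoch Q b'))"
      by (simp only: Suc.IH) simp
    also have "Q ^ a * (Q ^ (a * b') / (qpoch Q a * qpoch Q b'))
        = Q ^ (a * b) * (1 - Q ^ b) / (qpoch Q a * qpoch Q b)"
      using nz1[of b'] by (simp add: b power_add)
    also have "Q ^ (a * b) / (qpoch Q a * qpoch Q b) - \<dots> = Q ^ (Suc a * b) / (qpoch Q a * qpoch Q b)"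
      by (simp add: diff_divide_distrib[symmetric] algebra_simps power_add)
    finally show ?thesis by (simp add: b)
  qed
  finally have eq: "(1 - Q ^ Suc a) * ?T (Suc a) b = Q ^ (Suc a * b) / (qpoch Q a * qpoch Q b)" .
  have "x = r / u" if "u * x = r" "u \<noteq> 0" for x r u :: 'k
    using that by auto
  from this[OF eq nz1]
  have "?T (Suc a) b = Q ^ (Suc a * b) / (qpoch Q a * qpoch Q b) / (1 - Q ^ Suc a)" .
  then show ?case by (simp add: mult_ac)
qed

text \<open>Apply the identity with Q = p^2. From k^2 = k + 2 (k choose 2) the power p^(k^2)
  supplies Q^(k choose 2) and p^k = (-1)^k (-p)^k, after which the powers of -p combine to
  (-p)^(a+b), independent of k.\<close>

lemma pentagon_fps_qexp:
  fixes p :: "'k::field_char_0"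
  assumes p: "p \<noteq> 0" and roots: "\<And>j. j > 0 \<Longrightarrow> p ^ j \<noteq> inverse p ^ j"
  defines "e \<equiv> fps_nth (fps_qexp p)"
  shows "(\<Sum>k | k \<le> a \<and> k \<le> b. e (a - k) * e k * e (b - k) * p ^ (k * k))
      = e a * e b * (p ^ (a * b) * p ^ (a * b))"
proof -
  have nz: "qpoch (p\<^sup>2) n \<noteq> 0" for n
  proof -
    have "1 - (p\<^sup>2) ^ Suc i \<noteq> 0" for i
      using p roots by (rule one_minus_square_power_nonzero)
    then show ?thesis by (auto simp: qpoch_def)
  qed
  have e: "e n = (- p) ^ n / qpoch (p\<^sup>2) n" for n
    unfolding e_def using p roots by (rule fps_qexp_nth)
  have "(\<Sum>k | k \<le> a \<and> k \<le> b. e (a - k) * e k * e (b - k) * p ^ (k * k))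
      = (\<Sum>k | k \<le> a \<and> k \<le> b. (- p) ^ (a + b) * ((- 1) ^ k * (p\<^sup>2) ^ (k choose 2) / (qpoch (p\<^sup>2) (a - k) * qpoch (p\<^sup>2) k * qpoch (p\<^sup>2) (b - k))))"
  proof (rule sum.cong[OF refl])
    fix k assume "k \<in> {k. k \<le> a \<and> k \<le> b}"
    then have k: "k \<le> a" "k \<le> b" by auto
    have "k * k = k + 2 * (k choose 2)"
      by (induction k) (simp_all add: numeral_2_eq_2)
    then have "p ^ (k * k) = p ^ k * (p\<^sup>2) ^ (k choose 2)"
      by (simp add: power_add power_mult)
    moreover have "p ^ k = (- 1) ^ k * (- p) ^ k"
      by (simp flip: power_mult_distrib)
    moreover have "(- p) ^ (a - k) * (- p) ^ k * (- p) ^ (b - k) * (- p) ^ k = (- p) ^ (a + b)"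
      using k by (simp flip: power_add)
    ultimately show "e (a - k) * e k * e (b - k) * p ^ (k * k)
        = (- p) ^ (a + b) * ((- 1) ^ k * (p\<^sup>2) ^ (k choose 2) / (qpoch (p\<^sup>2) (a - k) * qpoch (p\<^sup>2) k * qpoch (p\<^sup>2) (b - k)))"
      unfolding e by (simp add: mult_ac)
  qed
  also have "\<dots> = (- p) ^ (a + b) * ((p\<^sup>2) ^ (a * b) / (qpoch (p\<^sup>2) a * qpoch (p\<^sup>2) b))"
    by (simp only: sum_distrib_left[symmetric] pentagon_qpoch[OF nz])
  also have "\<dots> = e a * e b * (p ^ (a * b) * p ^ (a * b))"
    unfolding e by (simp add: power_add power2_eq_square power_mult_distrib)
  finally show ?thesis .
qed


section \<open>Monomials in the twisted algebra\<close>

lemma smult_vec_Suc: "int (Suc k) *s m = m + int k *s m"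
  by (simp add: vec_eq_iff algebra_simps)

lemma smult_vec_0: "(0 :: int) *s m = 0"
  by (simp add: vec_eq_iff)

lemma cone_smult: "m \<in> cone \<Longrightarrow> int k *s m \<in> cone"
  by (simp add: cone_def)

lemma deg_smult: "deg (k *s m) = k * deg m"
  by (simp add: deg_def sum_distrib_left)

lemma Nplus_imp_cone: "n \<in> Nplus \<Longrightarrow> n \<in> cone"
  by (simp add: Nplus_iff_cone)

lemma le_deg_smult:
  assumes "m \<in> Nplus"
  shows "int k \<le> deg (int k *s m)"
  using assms mult_left_mono[of 1 "deg m" "int k"] by (simp add: deg_smult Nplus_iff_cone)

definition tmono :: "qfield \<Rightarrow> int ^ 'r::finite \<Rightarrow> 'r coeffs" where
  "tmono c m = (\<lambda>n. if n = m then c else 0)"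

lemma tmono_ghat: "m \<in> Nplus \<Longrightarrow> tmono c m \<in> ghat"
  by (auto simp: tmono_def ghat_def)

context twist
begin

lemma tmul_mono:
  assumes "m \<in> cone" "m' \<in> cone"
  shows "tmul (tmono c m) (tmono c' m') = tmono (c * c' * \<tau> m m') (m + m')"
proof
  fix n
  have "tmul (tmono c m) (tmono c' m') n = (\<Sum>p\<in>splits n. if p = (m, m') then c * c' * \<tau> m m' else 0)"
    unfolding tmul_def by (rule sum.cong) (auto simp: tmono_def split: if_splits)
  also have "\<dots> = (if (m, m') \<in> splits n then c * c' * \<tau> m m' else 0)"
    by (rule sum.delta) simp
  finally show "tmul (tmono c m) (tmono c' m') n = tmono (c * c' * \<tau> m m') (m + m') n"
    using assms by (auto simp: tmono_def splits_def)
qed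

lemma twist_smult: "\<tau> (int i *s m) (int j *s m') = \<tau> m m' ^ (i * j)"
proof -
  have 1: "\<tau> k (int j *s m') = \<tau> k m' ^ j" for k
    by (induction j) (simp_all add: smult_vec_Suc smult_vec_0 twist_add_right del: of_nat_Suc)
  have "\<tau> (int i *s m) k = \<tau> m k ^ i" for k
    by (induction i) (simp_all add: smult_vec_Suc smult_vec_0 twist_add_left del: of_nat_Suc)
  then show ?thesis by (simp add: 1 power_mult)
qed

lemma tpow_mono:
  assumes "m \<in> cone" "\<tau> m m = 1"
  shows "tpow (tmono c m) k = tmono (c ^ k) (int k *s m)"
proof (induction k)
  case 0
  then show ?case by (auto simp: tmono_def tone_def smult_vec_0)
next
  case (Suc k)
  then show ?case
    using assms twist_smult[of 1 m k m]
    by (simp add: tmul_mono cone_smult smult_vec_Suc del: of_nat_Suc)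
qed

text \<open>Any cutoff from \<open>deg n\<close> upward gives the same value, since
  \<open>int k *s m\<close> has degree at least \<open>k\<close>. All factors of a product can thus
  share one cutoff.\<close>

lemma tsub_mono:
  assumes "m \<in> Nplus" "\<tau> m m = 1" "deg n \<le> int d"
  shows "tsub (tmono c m) F n = (\<Sum>k\<le>d. fps_nth F k * tmono (c ^ k) (int k *s m) n)"
  unfolding tsub_def tpow_mono[OF Nplus_imp_cone[OF assms(1)] assms(2)]
proof (rule sum.mono_neutral_left)
  show "\<forall>k\<in>{..d} - {..nat (deg n)}. fps_nth F k * tmono (c ^ k) (int k *s m) n = 0"
  proof
    fix k assume "k \<in> {..d} - {..nat (deg n)}"
    then have "n \<noteq> int k *s m"
      using le_deg_smult[OF assms(1), of k] by auto
    then show "fps_nth F k * tmono (c ^ k) (int k *s m) n = 0" by (simp add: tmono_def)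
  qed
qed (use assms in auto)

lemma tmul_cong_deg:
  assumes "\<And>k. k \<in> cone \<Longrightarrow> deg k \<le> deg n \<Longrightarrow> f k = f' k" "\<And>k. k \<in> cone \<Longrightarrow> deg k \<le> deg n \<Longrightarrow> g k = g' k"
  shows "tmul f g n = tmul f' g' n"
proof (rule tmul_cong)
  fix k l :: "int ^ 'r" assume *: "k \<in> cone" "l \<in> cone" "k + l = n"
  then have "deg k \<le> deg n" "deg l \<le> deg n"
    using deg_nonneg[of k] deg_nonneg[of l] by (auto simp: deg_add)
  then show "f k * g l = f' k * g' l" using * assms by simp
qed

lemma tmul_tsub_mono:
  assumes m: "m \<in> Nplus" "\<tau> m m = 1" and m': "m' \<in> Nplus" "\<tau> m' m' = 1" and n: "deg n \<le> int d"
  shows "tmul (tsub (tmono c m) F) (tsub (tmono c' m') H) n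
    = (\<Sum>i\<le>d. \<Sum>j\<le>d. fps_nth F i * fps_nth H j
        * tmono (c ^ i * c' ^ j * \<tau> m m' ^ (i * j)) (int i *s m + int j *s m') n)"
proof -
  have "tmul (tsub (tmono c m) F) (tsub (tmono c' m') H) n
      = tmul (\<lambda>k. \<Sum>i\<le>d. fps_nth F i * tmono (c ^ i) (int i *s m) k)
             (\<lambda>k. \<Sum>j\<le>d. fps_nth H j * tmono (c' ^ j) (int j *s m') k) n"
    using n by (intro tmul_cong_deg tsub_mono m m') auto
  also have "\<dots> = (\<Sum>i\<le>d. \<Sum>j\<le>d. fps_nth F i * (fps_nth H j
      * tmul (tmono (c ^ i) (int i *s m)) (tmono (c' ^ j) (int j *s m')) n))"
    by (simp add: tmul_sum tmul_linear sum_distrib_left)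
  finally show ?thesis
    by (simp add: tmul_mono cone_smult Nplus_imp_cone m m' twist_smult mult.assoc)
qed

lemma tmul_tsub_mono_commute:
  assumes "m \<in> Nplus" "\<tau> m m = 1" "m' \<in> Nplus" "\<tau> m' m' = 1" "\<tau> m m' = 1" "\<tau> m' m = 1"
  shows "tmul (tsub (tmono c m) F) (tsub (tmono c' m') H)
      = tmul (tsub (tmono c' m') H) (tsub (tmono c m) F)"
proof
  fix n :: "int ^ 'r"
  have n: "deg n \<le> int (nat (deg n))" by simp
  show "tmul (tsub (tmono c m) F) (tsub (tmono c' m') H) n
      = tmul (tsub (tmono c' m') H) (tsub (tmono c m) F) n"
    unfolding tmul_tsub_mono[OF assms(1-4) n] tmul_tsub_mono[OF assms(3,4,1,2) n]
    by (subst sum.swap) (simp add: assms mult_ac add.commute)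
qed

lemma tmul_tsub_mono3:
  assumes m: "m \<in> Nplus" "\<tau> m m = 1" and m': "m' \<in> Nplus" "\<tau> m' m' = 1"
    and m'': "m'' \<in> Nplus" "\<tau> m'' m'' = 1" and n: "deg n \<le> int d"
  shows "tmul (tmul (tsub (tmono c m) F) (tsub (tmono c' m') F')) (tsub (tmono c'' m'') F'') n
    = (\<Sum>i\<le>d. \<Sum>k\<le>d. \<Sum>j\<le>d. fps_nth F i * fps_nth F' k * fps_nth F'' j
        * tmono (c ^ i * c' ^ k * c'' ^ j * \<tau> m m' ^ (i * k) * \<tau> m m'' ^ (i * j) * \<tau> m' m'' ^ (k * j))
            (int i *s m + int k *s m' + int j *s m'') n)"
proof -
  have "tmul (tmul (tsub (tmono c m) F) (tsub (tmono c' m') F')) (tsub (tmono c'' m'') F'') n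
      = tmul (\<lambda>l. \<Sum>i\<le>d. \<Sum>k\<le>d. fps_nth F i * fps_nth F' k
          * tmono (c ^ i * c' ^ k * \<tau> m m' ^ (i * k)) (int i *s m + int k *s m') l)
             (\<lambda>l. \<Sum>j\<le>d. fps_nth F'' j * tmono (c'' ^ j) (int j *s m'') l) n"
    using n by (intro tmul_cong_deg tsub_mono tmul_tsub_mono m m' m'') auto
  also have "\<dots> = (\<Sum>i\<le>d. \<Sum>k\<le>d. \<Sum>j\<le>d. fps_nth F i * fps_nth F' k * (fps_nth F'' j
      * tmul (tmono (c ^ i * c' ^ k * \<tau> m m' ^ (i * k)) (int i *s m + int k *s m')) (tmono (c'' ^ j) (int j *s m'')) n))"
    by (simp add: tmul_sum tmul_linear sum_distrib_left)
  finally show ?thesis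
    by (simp add: tmul_mono cone_add cone_smult Nplus_imp_cone m m' m'' twist_smult twist_add_left mult_ac)
qed

text \<open>With \<open>a = i + k\<close> and \<open>b = k + j\<close>, both sides are sums over the monomials \<open>a m\<^sub>1 + b m\<^sub>2\<close>, whose
  coefficients are compared by \<open>pentagon_fps_qexp\<close>.\<close>

lemma pentagon_tsub:
  assumes m1: "m1 \<in> Nplus" and m2: "m2 \<in> Nplus"
    and sq: "\<tau> m1 m1 = 1" "\<tau> m2 m2 = 1"
    and p: "\<tau> m2 m1 = p" "\<tau> m1 m2 = inverse p" "p \<noteq> 0"
    and roots: "\<And>j. j > 0 \<Longrightarrow> p ^ j \<noteq> inverse p ^ j"
  defines "E \<equiv> fps_qexp p"
  shows "tmul (tsub (tmono c2 m2) E) (tsub (tmono c1 m1) E)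
    = tmul (tmul (tsub (tmono c1 m1) E) (tsub (tmono (c1 * c2) (m1 + m2)) E)) (tsub (tmono c2 m2) E)"
proof
  fix n :: "int ^ 'r"
  define d where "d = nat (deg n)"
  have n: "deg n \<le> int d" by (simp add: d_def)
  define e where "e = fps_nth E"
  define h where "h a b = tmono (c1 ^ a * c2 ^ b) (int a *s m1 + int b *s m2) n" for a b
  have mono_h: "tmono (c1 ^ a * c2 ^ b * u) (int a *s m1 + int b *s m2) n = u * h a b" for a b u
    by (simp add: h_def tmono_def mult_ac)
  \<comment> \<open>If \<open>a\<close> or \<open>b\<close> exceeds \<open>d\<close>, the degree of
    the monomial exceeds that of \<open>n\<close>.\<close>
  have h0: "h a b = 0" if "\<not> (a \<le> d \<and> b \<le> d)" for a b
  proof -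
    have "int a \<le> deg (int a *s m1)" "int b \<le> deg (int b *s m2)"
      using le_deg_smult m1 m2 by auto
    then have "n \<noteq> int a *s m1 + int b *s m2"
      using that n by (auto simp: deg_add)
    then show ?thesis by (simp add: h_def tmono_def)
  qed
  have m12: "m1 + m2 \<in> Nplus" "\<tau> (m1 + m2) (m1 + m2) = 1"
    using m1 m2 sq p by (simp_all add: Nplus_add twist_add_left twist_add_right)
  have tw: "\<tau> m1 (m1 + m2) = inverse p" "\<tau> (m1 + m2) m2 = inverse p"
    using sq p by (simp_all add: twist_add_left twist_add_right)
  define g where "g i k j = e i * e k * e j * (inverse p ^ (i * k + i * j + k * j) * h (i
      + k) (k + j))" for i k j
  have "tmul (tmul (tsub (tmono c1 m1) E) (tsub (tmono (c1 * c2) (m1 + m2)) E)) (tsub (tmono c2 m2) E) n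
      = (\<Sum>i\<le>d. \<Sum>k\<le>d. \<Sum>j\<le>d. g i k j)"
  proof -
    have vec: "int i *s m1 + int k *s (m1 + m2) + int j *s m2
        = int (i + k) *s m1 + int (k + j) *s m2" for i k j
      by (simp add: vec_eq_iff algebra_simps)
    have "c1 ^ i * (c1 * c2) ^ k * c2 ^ j * inverse p ^ (i * k) * inverse p ^ (i * j)
        * inverse p ^ (k * j)
        = c1 ^ (i + k) * c2 ^ (k + j) * inverse p ^ (i * k + i * j + k * j)" for i k j
      by (simp add: power_add power_mult_distrib mult_ac)
    then show ?thesis
      unfolding tmul_tsub_mono3[OF m1 sq(1) m12 m2 sq(2) n] tw p(2) vec
      by (simp only: mono_h g_def e_def)
  qed
  also have "\<dots> = (\<Sum>(i, k, j)\<in>{..d} \<times> {..d} \<times> {..d}. g i k j)"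
    by (simp add: sum.cartesian_product)
  also have "\<dots> = (\<Sum>(i, k, j)\<in>{(i, k, j). i + k \<le> d \<and> k + j \<le> d}. g i k j)"
  proof (rule sum.mono_neutral_right)
    have "g i k j = 0" if "\<not> (i + k \<le> d \<and> k + j \<le> d)" for i k j
      using h0[OF that] by (simp add: g_def)
    then show "\<forall>p\<in>{..d} \<times> {..d} \<times> {..d} - {(i, k, j). i + k \<le> d \<and> k + j \<le> d}.
        (case p of (i, k, j) \<Rightarrow> g i k j) = 0"
      by auto
  qed auto
  also have "\<dots> = (\<Sum>((a, b), k)\<in>Sigma ({..d} \<times> {..d}) (\<lambda>(a, b). {k. k \<le> a \<and> k \<le> b}). g (a - k) k (b - k))"
    by (rule sum.reindex_bij_witness[of _ "\<lambda>((a, b), k). (a - k, k, b - k)" "\<lambda>(i, k, j). ((i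
        + k, k + j), k)"]) auto
  also have "\<dots> = (\<Sum>(a, b)\<in>{..d} \<times> {..d}. \<Sum>k | k \<le> a \<and> k \<le> b. g (a - k) k (b - k))"
    by (subst sum.Sigma[symmetric]) (auto simp: case_prod_unfold)
  also have "\<dots> = (\<Sum>(a, b)\<in>{..d} \<times> {..d}. e a * e b * p ^ (a * b) * h a b)"
  proof (intro sum.cong refl, clarify)
    fix a b
    \<comment> \<open>The twists contribute the exponent ik + ij + kj = (i+k)(k+j) - k^2; the
      surplus p^(k^2) is the weight in \<open>pentagon_fps_qexp\<close>.\<close>
    have "g (a - k) k (b - k) = inverse p ^ (a * b) * h a b * (e (a - k) * e k * e (b - k)
        * p ^ (k * k))"
      if k: "k \<le> a" "k \<le> b" for k
    proof -
      obtain i j where ij: "a = i + k" "b = k + j"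
        using k by (metis le_add_diff_inverse le_add_diff_inverse2)
      have "inverse p ^ (k * k) * p ^ (k * k) = 1"
        using p(3) by (simp flip: power_mult_distrib)
      then have "inverse p ^ (i * k + i * j + k * j) = inverse p ^ ((i + k) * (k + j)) * p ^ (k * k)"
        by (simp add: algebra_simps power_add)
      then show ?thesis by (simp add: g_def ij mult_ac)
    qed
    then have "(\<Sum>k | k \<le> a \<and> k \<le> b. g (a - k) k (b - k))
        = inverse p ^ (a * b) * h a b * (\<Sum>k | k \<le> a \<and> k \<le> b. e (a - k) * e k * e (b - k) * p ^ (k * k))"
      by (simp add: sum_distrib_left)
    also have "\<dots> = inverse p ^ (a * b) * h a b * (e a * e b * (p ^ (a * b) * p ^ (a * b)))"
      unfolding e_def E_def using pentagon_fps_qexp[OF p(3) roots] by simp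
    also have "\<dots> = (inverse p ^ (a * b) * p ^ (a * b)) * (e a * e b * p ^ (a * b) * h a b)"
      by (simp only: mult_ac)
    also have "inverse p ^ (a * b) * p ^ (a * b) = 1"
      using p(3) by (simp flip: power_mult_distrib)
    finally show "(\<Sum>k | k \<le> a \<and> k \<le> b. g (a - k) k (b - k)) = e a * e b * p ^ (a * b) * h a b"
      by simp
  qed
  also have "\<dots> = (\<Sum>b\<le>d. \<Sum>a\<le>d. e b * e a * (p ^ (b * a) * h a b))"
    by (subst sum.swap) (simp add: sum.cartesian_product mult_ac)
  also have "\<dots> = tmul (tsub (tmono c2 m2) E) (tsub (tmono c1 m1) E) n"
  proof -
    have "c2 ^ b * c1 ^ a * u = c1 ^ a * c2 ^ b * u" "int b *s m2 + int a *s m1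
        = int a *s m1 + int b *s m2" for a b u
      by (simp_all add: mult_ac add.commute)
    then show ?thesis
      unfolding tmul_tsub_mono[OF m2 sq(2) m1 sq(1) n] p(1)
      by (simp only: mono_h e_def)
  qed
  finally show "tmul (tsub (tmono c2 m2) E) (tsub (tmono c1 m1) E) n
    = tmul (tmul (tsub (tmono c1 m1) E) (tsub (tmono (c1 * c2) (m1 + m2)) E)) (tsub (tmono c2 m2) E) n" ..
qed

end


section \<open>The group \<open>G\<close>\<close>

lemma q_root_nonzero: "q_root \<noteq> 0"
  by (simp add: q_root_def Zero_fract_def eq_fract)

lemma q_root_power_ne_1: "k > 0 \<Longrightarrow> q_root ^ k \<noteq> 1"
proof
  assume k: "k > 0" and "q_root ^ k = 1"
  moreover have "q_root ^ k = Fract ([:0, 1:] ^ k) 1"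
    by (induction k) (simp_all add: q_root_def One_fract_def)
  ultimately have "[:0, 1:] ^ k = (1 :: rat poly)"
    by (simp add: One_fract_def eq_fract)
  then have "degree ([:0, 1:] ^ k :: rat poly) = 0" by simp
  then show False using k by (simp add: degree_power_eq)
qed

lemma qpow_frac: "\<delta>\<^sub>0 \<delta> > 0 \<Longrightarrow> qpow \<delta> (of_int k / of_nat (\<delta>\<^sub>0 \<delta>)) = q_root powi k"
  by (simp add: qpow_def)

lemma word_eq_pair_word: "word x y ps = pair_word x y ps"
  by (simp add: word_def pair_word_def)

lemma map_pair_word: "map f (pair_word x y ps) = pair_word (f x) (f y) ps"
  by (induction ps) (auto simp: pair_word_def)

lemma nested_bracket_ghat: "set xs \<subseteq> ghat \<Longrightarrow> nested_bracket B \<delta> xs \<in> ghat"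
proof (induction xs rule: nested_bracket.induct)
  case (1 B \<delta>)
  show ?case by (simp add: ghat_def)
qed (simp_all add: bracket_ghat)

lemma bch_ghat:
  assumes "x \<in> ghat" "y \<in> ghat"
  shows "bch B \<delta> x y \<in> ghat"
proof -
  have "nested_bracket B \<delta> (word x y ps) \<in> ghat" for ps
    by (rule nested_bracket_ghat)
      (use assms set_pair_word in \<open>fastforce simp: word_eq_pair_word\<close>)
  then show ?thesis
    by (auto simp: ghat_def bch_def intro!: sum.neutral)
qed

context fixed_data
begin

section \<open>Fractional exponents of q and the bicharacter given by the form\<close>

lemma \<delta>\<^sub>0_pos: "\<delta>\<^sub>0 \<delta> > 0"
proof -
  have "Lcm (range \<delta>) \<noteq> 0"
    using \<delta>_pos by (subst Lcm_0_iff) (auto simp: less_imp_neq[symmetric])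
  then show ?thesis unfolding \<delta>\<^sub>0_def by (rule neq0_conv[THEN iffD1])
qed

lemma B_0: "B 0 y = 0" "B y 0 = 0"
  using form_add_left[of 0 0 y] form_add_right[of y 0 0] by simp_all

lemma B_self: "B x x = 0"
  using form_skew[of x x] by simp

lemma B_smult: "B (int k *s x) y = of_nat k * B x y"
proof (induction k)
  case 0
  then show ?case by (simp add: smult_vec_0 B_0)
next
  case (Suc k)
  then show ?case
    unfolding smult_vec_Suc by (simp add: form_add_left algebra_simps)
qed

text \<open>Every \<open>\<delta> i\<close> divides \<open>\<delta>\<^sub>0 \<delta>\<close>, so
  multiplying \<open>x\<close> by the latter lands in the sublattice, where the form is
  integral.\<close>

lemma B_frac_ints: "B x y \<in> frac_ints \<delta>"
proof -
  let ?d = "\<delta>\<^sub>0 \<delta>"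
  have dvd: "\<delta> i dvd ?d" for i
    by (simp add: \<delta>\<^sub>0_def)
  have "int ?d *s x = (\<Sum>i\<in>UNIV. (x $ i * int (?d div \<delta> i) * int (\<delta> i)) *s axis i 1)"
  proof (subst vec_eq_iff, rule allI)
    fix i
    have "int (?d div \<delta> i) * int (\<delta> i) = int ?d"
      using dvd[of i] by (metis dvd_div_mult_self of_nat_mult)
    moreover have "(\<Sum>j\<in>UNIV. (x $ j * int (?d div \<delta> j) * int (\<delta> j)) *s axis j 1) $ i
        = (\<Sum>j\<in>UNIV. if j = i then x $ j * int (?d div \<delta> j) * int (\<delta> j) else 0)"
      unfolding sum_component by (intro sum.cong refl) (auto simp: axis_def)
    ultimately show "(int ?d *s x) $ i = (\<Sum>i\<in>UNIV. (x $ i * int (?d div \<delta> i)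
        * int (\<delta> i)) *s axis i 1) $ i"
      by (simp add: mult_ac)
  qed
  then have "int ?d *s x \<in> sublattice \<delta>"
    unfolding sublattice_def by (intro image_eqI[of _ _ "\<lambda>i. x $ i * int (?d div \<delta> i)"]) auto
  then have "of_nat ?d * B x y \<in> \<int>"
    using form_integral[of "int ?d *s x" y] by (simp add: B_smult)
  then obtain k where "of_nat ?d * B x y = of_int k" by (auto elim: Ints_cases)
  then have "B x y = of_int k / of_nat ?d"
    using \<delta>\<^sub>0_pos by (simp add: field_simps)
  then show ?thesis unfolding frac_ints_def by blast
qed

lemma frac_intsE:
  assumes "\<alpha> \<in> frac_ints \<delta>"
  obtains k where "\<alpha> = of_int k / of_nat (\<delta>\<^sub>0 \<delta>)"
  using assms by (auto simp: frac_ints_def)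

lemma one_frac_ints: "1 \<in> frac_ints \<delta>"
proof -
  have "(1 :: rat) = of_int (int (\<delta>\<^sub>0 \<delta>)) / of_nat (\<delta>\<^sub>0 \<delta>)"
    using \<delta>\<^sub>0_pos by simp
  then show ?thesis unfolding frac_ints_def by blast
qed

lemma frac_ints_of_nat_mult: "\<alpha> \<in> frac_ints \<delta> \<Longrightarrow> of_nat j * \<alpha> \<in> frac_ints \<delta>"
proof -
  assume "\<alpha> \<in> frac_ints \<delta>"
  then obtain k where "\<alpha> = of_int k / of_nat (\<delta>\<^sub>0 \<delta>)" by (rule frac_intsE)
  then have "of_nat j * \<alpha> = of_int (int j * k) / of_nat (\<delta>\<^sub>0 \<delta>)" by simp
  then show ?thesis unfolding frac_ints_def by blast
qed

lemma qpow_0: "qpow \<delta> 0 = 1"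
  by (simp add: qpow_def)

lemma qpow_add:
  assumes "\<alpha> \<in> frac_ints \<delta>" "\<beta> \<in> frac_ints \<delta>"
  shows "qpow \<delta> (\<alpha> + \<beta>) = qpow \<delta> \<alpha> * qpow \<delta> \<beta>"
proof -
  obtain k l where kl: "\<alpha> = of_int k / of_nat (\<delta>\<^sub>0 \<delta>)" "\<beta> = of_int l / of_nat (\<delta>\<^sub>0 \<delta>)"
    using assms by (meson frac_intsE)
  then have "\<alpha> + \<beta> = of_int (k + l) / of_nat (\<delta>\<^sub>0 \<delta>)"
    by (simp add: add_divide_distrib)
  then show ?thesis
    using kl \<delta>\<^sub>0_pos by (simp only: qpow_frac power_int_add q_root_nonzero simp_thms)
qed

lemma qpow_minus:
  assumes "\<alpha> \<in> frac_ints \<delta>"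
  shows "qpow \<delta> (- \<alpha>) = inverse (qpow \<delta> \<alpha>)"
proof -
  obtain k where k: "\<alpha> = of_int k / of_nat (\<delta>\<^sub>0 \<delta>)"
    using assms by (rule frac_intsE)
  then have "- \<alpha> = of_int (- k) / of_nat (\<delta>\<^sub>0 \<delta>)" by simp
  then show ?thesis
    using k \<delta>\<^sub>0_pos by (simp only: qpow_frac power_int_minus)
qed

lemma qpow_of_nat_mult:
  assumes "\<alpha> \<in> frac_ints \<delta>"
  shows "qpow \<delta> (of_nat j * \<alpha>) = qpow \<delta> \<alpha> ^ j"
proof -
  obtain k where k: "\<alpha> = of_int k / of_nat (\<delta>\<^sub>0 \<delta>)"
    using assms by (rule frac_intsE)
  then have "of_nat j * \<alpha> = of_int (k * int j) / of_nat (\<delta>\<^sub>0 \<delta>)" by simp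
  then show ?thesis
    using k \<delta>\<^sub>0_pos by (simp only: qpow_frac power_int_mult power_int_of_nat)
qed

lemma qpow_nonzero: "qpow \<delta> \<alpha> \<noteq> 0"
  by (simp add: qpow_def q_root_nonzero)

text \<open>A positive exponent makes \<open>qpow \<delta> \<alpha>\<close> a positive power of the
  indeterminate. This supplies the condition \<open>roots\<close>.\<close>

lemma qpow_power_ne:
  assumes "\<alpha> \<in> frac_ints \<delta>" "\<alpha> > 0" "j > 0"
  shows "qpow \<delta> \<alpha> ^ j \<noteq> inverse (qpow \<delta> \<alpha>) ^ j"
proof
  assume eq: "qpow \<delta> \<alpha> ^ j = inverse (qpow \<delta> \<alpha>) ^ j"
  obtain k where k: "\<alpha> = of_int k / of_nat (\<delta>\<^sub>0 \<delta>)"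
    using assms(1) by (rule frac_intsE)
  then have "k > 0" using assms(2) \<delta>\<^sub>0_pos by (simp add: zero_less_divide_iff)
  then obtain m where m: "k = int m" "m > 0" by (metis zero_less_imp_eq_int)
  have "qpow \<delta> \<alpha> = q_root ^ m"
    using qpow_frac[OF \<delta>\<^sub>0_pos, of k] by (simp only: k m power_int_of_nat)
  moreover have "qpow \<delta> \<alpha> ^ j * qpow \<delta> \<alpha> ^ j = 1"
    using eq qpow_nonzero[of \<alpha>] by (metis power_inverse power_not_zero right_inverse)
  ultimately have "q_root ^ (m * j + m * j) = 1"
    by (simp add: power_add power_mult)
  then show False using q_root_power_ne_1[of "m * j + m * j"] m assms(3) by simp
qed

text \<open>Because of the floor in \<open>qpow\<close>, its multiplicativity is drawn from
  exponents in \<open>frac_ints\<close>; \<open>B_frac_ints\<close> places the values of the form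
  there.\<close>

sublocale twist "\<lambda>k l. qpow \<delta> (B k l)"
  by unfold_locales (simp_all add: form_add_left form_add_right qpow_add B_frac_ints B_0 qpow_0)

section \<open>The embedding into the twisted algebra and the transfer of the group law\<close>

definition q_gap :: qfield where
  "q_gap = qpow \<delta> 1 - qpow \<delta> (- 1)"

lemma q_gap_nonzero: "q_gap \<noteq> 0"
  using qpow_power_ne[OF one_frac_ints, of 1] qpow_minus[OF one_frac_ints] by (simp add: q_gap_def)

text \<open>The generator \<open>X\<^sub>n\<close> corresponds to the monomial of degree \<open>n\<close> divided by \<open>q - q\<^bsup>-1\<^esup>\<close>;
  this turns the bracket into the commutator of the twisted product.\<close>

definition hat :: "'r coeffs \<Rightarrow> 'r coeffs" where
  "hat x = (\<lambda>n. x n / q_gap)"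

lemma hat_ghat: "x \<in> ghat \<Longrightarrow> hat x \<in> ghat"
  by (simp add: hat_def ghat_def)

lemma hat_inject: "hat x = hat y \<longleftrightarrow> x = y"
  by (auto simp: hat_def fun_eq_iff q_gap_nonzero)

text \<open>By skew-symmetry the swapped product carries the inverse twist. The difference of the
  twists is the q-number times \<open>q_gap\<close>, which cancels one of the two
  denominators.\<close>

lemma hat_bracket:
  assumes "x \<in> ghat" "y \<in> ghat"
  shows "hat (bracket B \<delta> x y) n = tmul (hat x) (hat y) n - tmul (hat y) (hat x) n"
proof -
  let ?S = "{(k, l). k \<in> Nplus \<and> l \<in> Nplus \<and> k + l = n}"
  have tm: "tmul (hat u) (hat v) n = (\<Sum>(k, l)\<in>?S. u k * v l / (q_gap * q_gap) * qpow \<delta> (B k l))"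
    if "u \<in> ghat" "v \<in> ghat" for u v
    unfolding tmul_def
    by (rule sum.mono_neutral_cong_right[OF finite_splits])
      (use that in \<open>auto simp: splits_def Nplus_imp_cone hat_def ghat_def\<close>)
  have "tmul (hat y) (hat x) n = (\<Sum>(k, l)\<in>?S. x k * y l / (q_gap * q_gap) * qpow \<delta> (- B k l))"
    unfolding tm[OF assms(2,1)]
    by (rule sum.reindex_bij_witness[of _ prod.swap prod.swap])
      (auto simp: add.commute mult.commute form_skew[symmetric])
  then have "tmul (hat x) (hat y) n - tmul (hat y) (hat x) n
      = (\<Sum>(k, l)\<in>?S. x k * y l * (qpow \<delta> (B k l) - qpow \<delta> (- B k l)) / (q_gap * q_gap))"
    by (simp add: tm[OF assms] sum_subtractf[symmetric] case_prod_unfold diff_divide_distrib right_diff_distrib)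
  then show ?thesis
    by (simp add: hat_def bracket_def qnum_def sum_divide_distrib case_prod_unfold flip: q_gap_def)
qed

lemma eval_nested_comm:
  fixes u :: "'a::finite \<Rightarrow> 'r coeffs"
  assumes u: "\<And>c. u c \<in> ghat"
  shows "eval_ncps (\<lambda>c. hat (u c)) (nested_comm (map letter cs)) = hat (nested_bracket B \<delta> (map u cs))"
proof (induction cs rule: induct_list012)
  have z: "hat (u c) \<in> ghat" for c using u by (rule hat_ghat)
  {
    case 1
    show ?case
      using eval_ncps_linear(3)[of "\<lambda>c. hat (u c)", OF z, of 0 0] by (simp add: hat_def fun_eq_iff)
  next
    case (2 c)
    show ?case by (simp add: eval_ncps_letter[of "\<lambda>c. hat (u c)", OF z])
  next
    case (3 c c' cs)
    have "nested_bracket B \<delta> (map u (c' # cs)) \<in> ghat"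
      using u by (intro nested_bracket_ghat) auto
    note br = hat_bracket[OF u this, of c]
    show ?case
    proof
      fix n
      show "eval_ncps (\<lambda>c. hat (u c)) (nested_comm (map letter (c # c' # cs))) n
          = hat (nested_bracket B \<delta> (map u (c # c' # cs))) n"
        using br[of n] 3(2)
        by (simp add: commutator_def eval_ncps_linear[of "\<lambda>c. hat (u c)", OF z]
            eval_ncps_mult[of "\<lambda>c. hat (u c)", OF z] eval_ncps_letter[of "\<lambda>c. hat (u c)", OF z])
    qed
  }
qed

text \<open>Evaluation respects products and substitutions, so the identity exp (ln U) = U for free
  letters descends. It remains to recognize the evaluated logarithm as \<open>bch\<close>, degree by
  degree.\<close>

lemma exp_bch:
  assumes x: "x \<in> ghat" and y: "y \<in> ghat"
  shows "tsub (hat (bch B \<delta> x y)) (fps_exp 1) = tmul (tsub (hat x) (fps_exp 1)) (tsub (hat y) (fps_exp 1))"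
proof -
  \<comment> \<open>The alphabet is \<open>bool\<close>, with \<open>True\<close> for
    \<open>x\<close> and \<open>False\<close> for \<open>y\<close>.\<close>
  define u where "u c = (if c then x else y)" for c
  let ?z = "\<lambda>c. hat (u c)"
  have u: "u c \<in> ghat" for c using x y by (simp add: u_def)
  then have z: "?z c \<in> ghat" for c by (rule hat_ghat)
  note ev = eval_ncps_subst[of ?z, OF z] eval_ncps_mult[of ?z, OF z] eval_ncps_letter[of ?z, OF z]
  have log: "eval_ncps ?z (bch_log True False) = hat (bch B \<delta> x y)"
  proof
    fix n :: "int ^ 'r"
    let ?d = "nat (deg n)"
    let ?I = "{ps. ps \<noteq> [] \<and> (\<forall>(r, s)\<in>set ps. r + s > 0) \<and> int (word_length ps) \<le> int ?d}"
    let ?c = "\<lambda>ps. nested_comm (pair_word (letter True) (letter False) ps) :: (bool, qfield) ncps"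
    show "eval_ncps ?z (bch_log True False) n = hat (bch B \<delta> x y) n"
    \<comment> \<open>Inside the cone \<open>deg n\<close> is nonnegative, so the cutoff in
      \<open>bch\<close> is the natural number \<open>?d\<close>; outside it both sides
      vanish.\<close>
    proof (cases "n \<in> cone")
      case False
      then show ?thesis
        using hat_ghat[OF bch_ghat[OF x y]] eval_ncps_outside[of ?z, OF z False]
        by (simp add: ghat_def Nplus_iff_cone)
    next
      case True
      have "agree ?d (bch_log True False) (\<Sum>ps\<in>?I. scl (dynkin_coeff ps) (?c ps))"
        unfolding agree_def by (auto simp: nth_bch_log)
      then have "eval_ncps ?z (bch_log True False) n
          = eval_upto ?z ?d (\<Sum>ps\<in>?I. scl (dynkin_coeff ps) (?c ps)) n"
        unfolding eval_ncps_def by (simp only: eval_upto_agree)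
      also have "\<dots> = (\<Sum>ps\<in>?I. dynkin_coeff ps * eval_ncps ?z (?c ps) n)"
        by (simp only: eval_upto_sum eval_upto_linear eval_ncps_def)
      also have "\<dots> = (\<Sum>ps\<in>?I. dynkin_coeff ps * hat (nested_bracket B \<delta> (word x y ps)) n)"
      proof (intro sum.cong refl)
        fix ps
        have "?c ps = nested_comm (map letter (pair_word True False ps))"
          by (simp add: map_pair_word)
        moreover have "word x y ps = map u (pair_word True False ps)"
          by (simp add: word_eq_pair_word map_pair_word u_def)
        ultimately show "dynkin_coeff ps * eval_ncps ?z (?c ps) n
            = dynkin_coeff ps * hat (nested_bracket B \<delta> (word x y ps)) n"
          by (simp only: eval_nested_comm[of u, OF u])
      qed
      also have "\<dots> = hat (bch B \<delta> x y) n"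
        using deg_nonneg[OF True] by (simp add: hat_def bch_def sum_divide_distrib)
      finally show ?thesis .
    qed
  qed
  have "tsub (hat (bch B \<delta> x y)) (fps_exp 1) = eval_ncps ?z (subst (bch_log True False) (fps_exp 1))"
    by (simp add: ev log nth_bch_log_Nil)
  also have "\<dots> = eval_ncps ?z (subst (letter True) (fps_exp 1) * subst (letter False) (fps_exp 1))"
    by (simp only: exp_bch_log bch_prod_def)
  also have "\<dots> = tmul (tsub (hat x) (fps_exp 1)) (tsub (hat y) (fps_exp 1))"
    by (simp add: ev nth_letter) (simp add: u_def)
  finally show ?thesis .
qed

section \<open>Quantum dilogarithm elements\<close>

lemma Log_Psi_ghat: "n \<in> Nplus \<Longrightarrow> Log (Psi \<delta> a b n) \<in> ghat"
  using Psi_in_G[of n \<delta> a b B] by (auto simp: G_def)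

text \<open>Since \<open>B n n = 0\<close>, the monomial of degree jn is the untwisted j-th power of
  the one of degree n, so the exponent of \<open>Psi\<close> is a power series in a single
  monomial.\<close>

lemma Psi_tsub:
  assumes n: "n \<in> Nplus" and a: "a \<in> frac_ints \<delta>" and b: "b \<in> frac_ints \<delta>"
  shows "hat (Log (Psi \<delta> a b n)) = tsub (tmono (qpow \<delta> b) n) (fps_dilog (qpow \<delta> a))"
proof
  fix m
  let ?p = "qpow \<delta> a"
  have qn: "qnum \<delta> (of_nat j * a) = (?p ^ j - inverse ?p ^ j) / q_gap" for j
    using a by (simp add: qnum_def q_gap_def qpow_of_nat_mult qpow_minus frac_ints_of_nat_mult power_inverse)
  let ?J = "{j. 1 \<le> j \<and> m = int j *s n}"
  have "tsub (tmono (qpow \<delta> b) n) (fps_dilog ?p) m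
      = (\<Sum>j\<le>nat (deg m). fps_nth (fps_dilog ?p) j * tmono (qpow \<delta> b ^ j) (int j *s n) m)"
    using n by (intro tsub_mono) (simp_all add: B_self qpow_0)
  also have "\<dots> = (\<Sum>j\<in>?J. fps_nth (fps_dilog ?p) j * qpow \<delta> b ^ j)"
  proof (rule sum.mono_neutral_cong_right)
    show "?J \<subseteq> {..nat (deg m)}"
    proof
      fix j assume "j \<in> ?J"
      then have "int j \<le> deg m" using le_deg_smult[OF n, of j] by simp
      then show "j \<in> {..nat (deg m)}" using nat_mono[of "int j" "deg m"] by simp
    qed
  qed (auto simp: tmono_def fps_dilog_def Suc_le_eq)
  also have "\<dots> = hat (Log (Psi \<delta> a b n)) m"
    unfolding hat_def Psi_def Log.simps sum_divide_distrib
    by (intro sum.cong refl) (use b q_gap_nonzero in \<open>auto simp: fps_dilog_def qn qpow_of_nat_mult\<close>)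
  finally show "hat (Log (Psi \<delta> a b n)) m = tsub (tmono (qpow \<delta> b) n) (fps_dilog ?p) m" ..
qed

lemma exp_Psi:
  assumes n: "n \<in> Nplus" and a: "a \<in> frac_ints \<delta>" and b: "b \<in> frac_ints \<delta>"
  shows "tsub (hat (Log (Psi \<delta> a b n))) (fps_exp 1) = tsub (tmono (qpow \<delta> b) n) (fps_qexp (qpow \<delta> a))"
  unfolding Psi_tsub[OF assms] fps_qexp_def
  by (rule tsub_compose) (simp_all add: tmono_ghat n fps_dilog_def)

text \<open>Reduces relations in G to products of exponentials in the twisted algebra.\<close>

lemma bch_eqI:
  assumes "x \<in> ghat" "y \<in> ghat" "x' \<in> ghat" "y' \<in> ghat"
    and "tmul (tsub (hat x) (fps_exp 1)) (tsub (hat y) (fps_exp 1))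
       = tmul (tsub (hat x') (fps_exp 1)) (tsub (hat y') (fps_exp 1))"
  shows "bch B \<delta> x y = bch B \<delta> x' y'"
proof -
  have "hat (bch B \<delta> x y) = hat (bch B \<delta> x' y')"
    by (rule exp_injective) (use assms in \<open>simp_all add: exp_bch hat_ghat bch_ghat\<close>)
  then show ?thesis by (simp only: hat_inject)
qed

lemma Psi_commute:
  assumes n: "n1 \<in> Nplus" "n2 \<in> Nplus" and B: "B n2 n1 = 0"
    and ab: "a1 \<in> frac_ints \<delta>" "a2 \<in> frac_ints \<delta>" "b1 \<in> frac_ints \<delta>" "b2 \<in> frac_ints \<delta>"
  shows "Psi \<delta> a2 b2 n2 \<otimes>\<^bsub>G B \<delta>\<^esub> Psi \<delta> a1 b1 n1 = Psi \<delta> a1 b1 n1 \<otimes>\<^bsub>G B \<delta>\<^esub> Psi \<delta> a2 b2 n2"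
proof -
  have "B n1 n2 = 0" using form_skew[of n1 n2] B by simp
  then have "bch B \<delta> (Log (Psi \<delta> a2 b2 n2)) (Log (Psi \<delta> a1 b1 n1))
      = bch B \<delta> (Log (Psi \<delta> a1 b1 n1)) (Log (Psi \<delta> a2 b2 n2))"
    by (intro bch_eqI Log_Psi_ghat n)
      (unfold exp_Psi[OF n(1) ab(1,3)] exp_Psi[OF n(2) ab(2,4)],
        rule tmul_tsub_mono_commute, simp_all add: n B B_self qpow_0)
  then show ?thesis by (simp add: G_def)
qed

lemma Psi_pentagon:
  assumes n: "n1 \<in> Nplus" "n2 \<in> Nplus" and c: "c \<in> frac_ints \<delta>" "c > 0" "B n2 n1 = c"
    and b: "b1 \<in> frac_ints \<delta>" "b2 \<in> frac_ints \<delta>"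
  shows "Psi \<delta> c b2 n2 \<otimes>\<^bsub>G B \<delta>\<^esub> Psi \<delta> c b1 n1
    = Psi \<delta> c b1 n1 \<otimes>\<^bsub>G B \<delta>\<^esub> Psi \<delta> c (b1 + b2) (n1 + n2) \<otimes>\<^bsub>G B \<delta>\<^esub> Psi \<delta> c b2 n2"
proof -
  let ?x1 = "Log (Psi \<delta> c b1 n1)" and ?x2 = "Log (Psi \<delta> c b2 n2)" and ?x12 = "Log (Psi \<delta> c (b1
      + b2) (n1 + n2))"
  have x: "?x1 \<in> ghat" "?x2 \<in> ghat" "?x12 \<in> ghat"
    using n by (simp_all add: Log_Psi_ghat Nplus_add)
  have "B n1 n2 = - c" using form_skew[of n1 n2] c by simp
  then have inv: "qpow \<delta> (B n1 n2) = inverse (qpow \<delta> c)" using c by (simp add: qpow_minus)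
  have b12: "b1 + b2 \<in> frac_ints \<delta>"
  proof -
    obtain k l where "b1 = of_int k / of_nat (\<delta>\<^sub>0 \<delta>)" "b2 = of_int l / of_nat (\<delta>\<^sub>0 \<delta>)"
      using b by (meson frac_intsE)
    then have "b1 + b2 = of_int (k + l) / of_nat (\<delta>\<^sub>0 \<delta>)" by (simp add: add_divide_distrib)
    then show ?thesis unfolding frac_ints_def by blast
  qed
  have "bch B \<delta> ?x2 ?x1 = bch B \<delta> (bch B \<delta> ?x1 ?x12) ?x2"
  proof (rule bch_eqI)
    show "tmul (tsub (hat ?x2) (fps_exp 1)) (tsub (hat ?x1) (fps_exp 1))
        = tmul (tsub (hat (bch B \<delta> ?x1 ?x12)) (fps_exp 1)) (tsub (hat ?x2) (fps_exp 1))"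
      \<comment> \<open>\<open>qpow_add\<close> writes the prefactor for \<open>n1 + n2\<close> as
        the product of the other two, the shape demanded by \<open>pentagon_tsub\<close>; all three
        series have the same parameter p = q^c, which is also the twist of \<open>n2\<close> against
        \<open>n1\<close>.\<close>
      unfolding exp_bch[OF x(1,3)] exp_Psi[OF n(1) c(1) b(1)] exp_Psi[OF n(2) c(1) b(2)]
        exp_Psi[OF Nplus_add[OF n] c(1) b12] qpow_add[OF b]
      by (rule pentagon_tsub) (use n c inv in \<open>simp_all add: B_self qpow_0 qpow_nonzero qpow_power_ne del: power_inverse\<close>)
  qed (use x bch_ghat in auto)
  then show ?thesis by (simp add: G_def)
qed

end


theorem theorem2p7:
  fixes B :: "int ^ 'r::finite \<Rightarrow> int ^ 'r \<Rightarrow> rat"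
    and \<delta> :: "'r \<Rightarrow> nat"
    and n1 n2 :: "int ^ 'r"
  assumes "fixed_data B \<delta>"
    and "n1 \<in> Nplus" and "n2 \<in> Nplus"
  shows "(B n2 n1 = 0 \<longrightarrow>
            (\<forall>a1 \<in> frac_ints \<delta>. \<forall>a2 \<in> frac_ints \<delta>. \<forall>b1 \<in> frac_ints \<delta>. \<forall>b2 \<in> frac_ints \<delta>.
               a1 > 0 \<longrightarrow> a2 > 0 \<longrightarrow>
               Psi \<delta> a2 b2 n2 \<otimes>\<^bsub>G B \<delta>\<^esub> Psi \<delta> a1 b1 n1
                 = Psi \<delta> a1 b1 n1 \<otimes>\<^bsub>G B \<delta>\<^esub> Psi \<delta> a2 b2 n2))
       \<and> (\<forall>c \<in> frac_ints \<delta>. c > 0 \<longrightarrow> B n2 n1 = c \<longrightarrow>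
            (\<forall>b1 \<in> frac_ints \<delta>. \<forall>b2 \<in> frac_ints \<delta>.
               Psi \<delta> c b2 n2 \<otimes>\<^bsub>G B \<delta>\<^esub> Psi \<delta> c b1 n1
                 = Psi \<delta> c b1 n1 \<otimes>\<^bsub>G B \<delta>\<^esub> Psi \<delta> c (b1 + b2) (n1 + n2) \<otimes>\<^bsub>G B \<delta>\<^esub> Psi \<delta> c b2 n2))"
proof -
  interpret fixed_data B \<delta> by (rule assms(1))
  show ?thesis
    using Psi_commute[OF assms(2,3)] Psi_pentagon[OF assms(2,3)] by blast
qed

end
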